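(* There exist absolute constants $0<c\leqslant C$ such that the following holds. Let $n\geqslant 1$ and $k\geqslant 2$ be integers, let $\sigma^2>0$, and let $d\leqslant k$ be a positive even integer. Consider tuples of real random variables $(X_i)_{i=1}^n$ satisfying: (a) $(X_i)_{i=1}^n$ are $k$-wise independent and $|X_i-\mathbb{E}X_i|\leqslant 1$ for every $i$; (b) $\sum_{i=1}^n \mathbb{V}[X_i]\leqslant n\sigma^2$. Write $S=\sum_{i=1}^n X_i$ and define $$M(n,\sigma^2,d)=\begin{cases}\sqrt{dn\sigma^2} & \text{if } \log(d/n\sigma^2)<\max(d/n,2),\\[2pt] \dfrac{d}{\log(d/n\sigma^2)} & \text{if } \max(d/n,2)\leqslant \log(d/n\sigma^2)\leqslant d,\\[2pt] (n\sigma^2)^{1/d} & \text{if } d<\log(d/n\sigma^2).\end{cases}$$ Then $$c\, M(n,\sigma^2,d)\;\leqslant\; \max_{(X_i)}\|S-\mathbb{E}S\|_d\;\leqslant\; C\, M(n,\sigma^2,d),$$ where the maximum is over all tuples $(X_i)_{i=1}^n$ satisfying (a) and (b). Moreover, the maximal value is realized, up to an absolute constant factor, when each $X_i$ is distributed as $B-B'$, where $B,B'$ are independent and identically distributed $\mathrm{Bern}(p)$ variables with $p=\frac12\bigl(1-\sqrt{1-2\sigma^2}\bigr)$.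
   Context: For a real random variable $Z$, $\|Z\|_d=(\mathbb{E}|Z|^d)^{1/d}$, and $\mathbb{E}Z$, $\mathbb{V}[Z]$ denote its mean and variance. Random variables $X_1,\dots,X_n$ are $k$-wise independent if any $k$ of them are independent (they may be differently distributed). $\log$ is the natural logarithm and $d/n\sigma^2$ means $d/(n\sigma^2)$. $\mathrm{Bern}(p)$ is the distribution on $\{0,1\}$ with mass $p$ at $1$. An absolute constant does not depend on any of $n,k,d,\sigma^2$ or on the distributions.
   Formalization: The lower bound is claimed only for σ² ≤ 1 and the final clause only for σ² ≤ 1/2 (otherwise p is not real); for k > n (mutual independence) both bounds are omitted when 2 ≤ log(d/nσ²) < d/n. The claim as printed fails without these limits. *)

theory Defs
  imports "HOL-Probability.Probability"
begin

(* A tuple is given by X i for i < n. For k <= n it suffices to consider sets J with exactly k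
   elements; for k > n the condition is mutual independence of the whole tuple. For k >= 1 it
   includes measurability of each X i (take J = {i}). *)
definition kwise_indep :: "'a measure \<Rightarrow> nat \<Rightarrow> nat \<Rightarrow> (nat \<Rightarrow> 'a \<Rightarrow> real) \<Rightarrow> bool" where
  "kwise_indep P n k X \<longleftrightarrow>
     (\<forall>J. J \<subseteq> {..<n} \<and> card J \<le> k \<longrightarrow> prob_space.indep_vars P (\<lambda>_. borel) X J)"

abbreviation mean :: "'a measure \<Rightarrow> ('a \<Rightarrow> real) \<Rightarrow> real" where
  "mean P Z \<equiv> integral\<^sup>L P Z"

definition var :: "'a measure \<Rightarrow> ('a \<Rightarrow> real) \<Rightarrow> real" where
  "var P Z = mean P (\<lambda>\<omega>. (Z \<omega> - mean P Z)\<^sup>2)"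

(* The parameter s2 (a real number, not a square root) stands for sigma squared. The almost sure
   bound forces each X i to be integrable, so that mean and var have their usual meaning. *)
definition admissible ::
    "'a measure \<Rightarrow> nat \<Rightarrow> nat \<Rightarrow> real \<Rightarrow> (nat \<Rightarrow> 'a \<Rightarrow> real) \<Rightarrow> bool" where
  "admissible P n k s2 X \<longleftrightarrow>
     kwise_indep P n k X \<and>
     (\<forall>i<n. AE \<omega> in P. \<bar>X i \<omega> - mean P (X i)\<bar> \<le> 1) \<and>
     (\<Sum>i<n. var P (X i)) \<le> real n * s2"

definition Lp_norm :: "'a measure \<Rightarrow> nat \<Rightarrow> ('a \<Rightarrow> real) \<Rightarrow> real" where
  "Lp_norm P d Z = mean P (\<lambda>\<omega>. \<bar>Z \<omega>\<bar> ^ d) powr (1 / real d)"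

definition centred_norm :: "'a measure \<Rightarrow> nat \<Rightarrow> nat \<Rightarrow> (nat \<Rightarrow> 'a \<Rightarrow> real) \<Rightarrow> real" where
  "centred_norm P n d X =
     Lp_norm P d (\<lambda>\<omega>. (\<Sum>i<n. X i \<omega>) - mean P (\<lambda>\<omega>. \<Sum>i<n. X i \<omega>))"

(* The values over which the maximum is taken. Fixing the type of the sample space loses nothing:
   see attainable_norms_universal below. *)
definition attainable_norms :: "nat \<Rightarrow> nat \<Rightarrow> real \<Rightarrow> nat \<Rightarrow> real set" where
  "attainable_norms n k s2 d =
     {centred_norm P n d X | (P :: (nat \<Rightarrow> real) measure) X.
        prob_space P \<and> admissible P n k s2 X}"

definition moment_rate :: "nat \<Rightarrow> real \<Rightarrow> nat \<Rightarrow> real" where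
  "moment_rate n s2 d =
     (let L = ln (real d / (real n * s2)) in
      if L < max (real d / real n) 2 then sqrt (real d * real n * s2)
      else if L \<le> real d then real d / L
      else (real n * s2) powr (1 / real d))"

definition bern_diff_law :: "real \<Rightarrow> real measure" where
  "bern_diff_law p =
     distr (measure_pmf (pair_pmf (bernoulli_pmf p) (bernoulli_pmf p))) borel
       (\<lambda>(b, b'). of_bool b - of_bool b')"

(* For 0 < s2 <= 1/2 the law of B - B' has mass s2/2 at each of 1 and -1;
   for s2 > 1/2 the parameter of the Bernoulli law is not a real number. *)
definition bern_diff_tuple ::
    "'a measure \<Rightarrow> nat \<Rightarrow> nat \<Rightarrow> real \<Rightarrow> (nat \<Rightarrow> 'a \<Rightarrow> real) \<Rightarrow> bool" where
  "bern_diff_tuple P n k s2 X \<longleftrightarrow>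
     kwise_indep P n k X \<and>
     (\<forall>i<n. distr P borel (X i) = bern_diff_law ((1 - sqrt (1 - 2 * s2)) / 2))"

lemma attainable_norms_universal:
  fixes P :: "'a measure"
  assumes P: "prob_space P" and k: "k \<ge> 1" and adm: "admissible P n k s2 X"
  shows "centred_norm P n d X \<in> attainable_norms n k s2 d"
proof -
  interpret prob_space P by fact
  have ind: "J \<subseteq> {..<n} \<Longrightarrow> card J \<le> k \<Longrightarrow> indep_vars (\<lambda>_. borel) X J" for J
    using adm by (auto simp: admissible_def kwise_indep_def)
  have X [measurable]: "X i \<in> borel_measurable P" if "i < n" for i
    using ind[of "{i}"] that k by (auto simp: indep_vars_def)
  define T :: "'a \<Rightarrow> nat \<Rightarrow> real" where "T \<omega> i = (if i < n then X i \<omega> else 0)" for \<omega> i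
  define N :: "(nat \<Rightarrow> real) measure" where "N = Pi\<^sub>M UNIV (\<lambda>_. borel)"
  have T [measurable]: "T \<in> P \<rightarrow>\<^sub>M N"
    unfolding N_def
  proof (rule measurable_PiM_single')
    fix i show "(\<lambda>\<omega>. T \<omega> i) \<in> borel_measurable P"
      by (cases "i < n") (simp_all add: T_def)
  qed auto
  have co [measurable]: "(\<lambda>f. f i) \<in> borel_measurable N" for i
    unfolding N_def by measurable
  define Q where "Q = distr P N T"
  define Y :: "nat \<Rightarrow> (nat \<Rightarrow> real) \<Rightarrow> real" where "Y i f = f i" for i f
  have Y [measurable]: "Y i \<in> borel_measurable N" for i
    unfolding Y_def by measurable
  have YT: "Y i (T \<omega>) = X i \<omega>" if "i < n" for i \<omega> using that by (simp add: Y_def T_def)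
  interpret Q: prob_space Q unfolding Q_def by (rule prob_space_distr) simp
  have YQ: "Y i \<in> borel_measurable Q" for i unfolding Q_def by simp
  have mQ: "mean Q g = mean P (\<lambda>\<omega>. g (T \<omega>))" if "g \<in> borel_measurable N" for g :: "_ \<Rightarrow> real"
    unfolding Q_def using that by (intro integral_distr) auto
  have m: "mean Q (Y i) = mean P (X i)" if "i < n" for i
    using that by (simp add: mQ YT)
  have v: "var Q (Y i) = var P (X i)" if "i < n" for i
    using that by (simp add: var_def m mQ YT)
  have "Q.indep_vars (\<lambda>_. borel) Y J" if J: "J \<subseteq> {..<n}" "card J \<le> k" for J
  proof (cases "J = {}")
    case True
    then show ?thesis by (simp add: Q.indep_vars_def Q.indep_sets_def)
  next
    case False
    have sub: "i \<in> J \<Longrightarrow> i < n" for i using J by auto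
    have [measurable]: "(\<lambda>x. \<lambda>i\<in>J. Y i x) \<in> N \<rightarrow>\<^sub>M (\<Pi>\<^sub>M i\<in>J. borel)"
      by (rule measurable_restrict) simp
    have "distr Q (\<Pi>\<^sub>M i\<in>J. borel) (\<lambda>x. \<lambda>i\<in>J. Y i x)
        = distr P (\<Pi>\<^sub>M i\<in>J. borel) (\<lambda>x. \<lambda>i\<in>J. X i x)"
      unfolding Q_def
      by (subst distr_distr) (auto intro!: distr_cong simp: YT sub)
    also have "\<dots> = (\<Pi>\<^sub>M i\<in>J. distr P borel (X i))"
      using ind[OF J] False sub by (subst (asm) indep_vars_iff_distr_eq_PiM') auto
    also have "\<dots> = (\<Pi>\<^sub>M i\<in>J. distr Q borel (Y i))"
      unfolding Q_def
      by (intro PiM_cong refl, subst distr_distr) (auto intro!: distr_cong simp: YT sub)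
    finally show ?thesis
      using False YQ by (subst Q.indep_vars_iff_distr_eq_PiM') auto
  qed
  moreover have "AE f in Q. \<bar>Y i f - mean Q (Y i)\<bar> \<le> 1" if "i < n" for i
    using adm that unfolding m[OF that] unfolding Q_def
    by (subst AE_distr_iff) (auto simp: YT admissible_def)
  moreover have "(\<Sum>i<n. var Q (Y i)) \<le> real n * s2"
    using adm by (simp add: v admissible_def)
  ultimately have "admissible Q n k s2 Y"
    by (auto simp: admissible_def kwise_indep_def)
  moreover have "centred_norm Q n d Y = centred_norm P n d X"
    by (simp add: centred_norm_def Lp_norm_def mQ YT)
  ultimately show ?thesis
    unfolding attainable_norms_def
    by (intro CollectI exI[of _ Q] exI[of _ Y]) (auto intro: Q.prob_space_axioms)
qed

end

theory Submission
  imports Defs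
begin

text \<open>
  Since \<open>d \<le> k\<close>, the \<open>d\<close>-th moment of the centred sum depends only on the moments of the centred
  summands, as if these were fully independent: up to factorials it is a coefficient of the
  product of their exponential generating functions.  The maximum is attained because laws on
  \<open>[-1, 1]\<close> are weakly sequentially compact (Helly).

  Write \<open>W = n \<sigma>\<^sup>2\<close> and \<open>L = ln (d / W)\<close>.  As the moments of order \<open>u \<ge> 2\<close> are at most the variance,
  the \<open>d\<close>-th moment is at most \<open>(d / t)\<^sup>d (exp (W (e\<^sup>t - 1 - t)) - 1)\<close> for every \<open>t > 0\<close>; the choices
  \<open>t = \<surd>(d / W) / e\<close>, \<open>t = L\<close> and \<open>t = d\<close> give the three regimes of the upper bound.

  For the lower bound let the summands take the values \<open>1\<close> and \<open>-1\<close> with probability \<open>q / 2\<close> each.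
  All moments are nonnegative, so it suffices to retain a few terms: pairs of equal indices in the
  first regime, the event that exactly \<open>l \<approx> d / L\<close> summands equal \<open>1\<close> and the others vanish in the
  second, and the diagonal terms in the third.  In the range \<open>2 \<le> L < d / n\<close> the trivial bound
  \<open>n\<close> is attained up to a constant on the event that all summands are \<open>1\<close>.
\<close>

section \<open>Moments of sums as binomial convolutions\<close>

text \<open>If \<open>x i\<close> lists the moments of the i-th of n independent variables, this is
  the d-th moment of their sum, with the last summand split off by the binomial theorem. Arbitrary
  arrays are allowed, so that estimates and limits can be carried out on numbers alone.\<close>

primrec sum_moment :: "(nat \<Rightarrow> nat \<Rightarrow> real) \<Rightarrow> nat \<Rightarrow> nat \<Rightarrow> real" where
  "sum_moment x 0 d = 0 ^ d"
| "sum_moment x (Suc n) d = (\<Sum>j\<le>d. real (d choose j) * sum_moment x n j * x n (d - j))"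

lemma sum_moment_0: "(\<And>i. i < n \<Longrightarrow> x i 0 = 1) \<Longrightarrow> sum_moment x n 0 = 1"
  by (induction n) auto

lemma sum_moment_cong: "(\<And>i u. i < n \<Longrightarrow> x i u = y i u) \<Longrightarrow> sum_moment x n d = sum_moment y n d"
  by (induction n arbitrary: d) auto

lemma sum_moment_nonneg: "(\<And>i u. i < n \<Longrightarrow> 0 \<le> x i u) \<Longrightarrow> 0 \<le> sum_moment x n d"
  by (induction n arbitrary: d) (auto intro!: sum_nonneg mult_nonneg_nonneg)

lemma tendsto_sum_moment:
  assumes "\<And>i u. i < n \<Longrightarrow> ((\<lambda>j. x j i u) \<longlongrightarrow> y i u) F"
  shows "((\<lambda>j. sum_moment (x j) n d) \<longlongrightarrow> sum_moment y n d) F"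
  using assms by (induction n arbitrary: d) (auto intro!: tendsto_intros)

section \<open>Upper bound for moments of sums\<close>

lemma weighted_choose_eq:
  assumes "j \<le> d"
  shows "real (d choose j) * t ^ d / fact d = (t ^ j / fact j) * (t ^ (d - j) / fact (d - j))"
  using assms by (simp add: binomial_fact field_simps flip: power_add)

text \<open>After weighting by \<open>t ^ d / fact d\<close> the binomial convolution becomes a
  Cauchy product, so the weighted sums are submultiplicative. Each factor contributes 1 from order
  0, nothing from order 1, and at most \<open>v i\<close> times the rest of the exponential series.
  Truncation at \<open>D\<close> avoids any question of convergence.\<close>

lemma sum_abs_sum_moment_le:
  fixes x :: "nat \<Rightarrow> nat \<Rightarrow> real" and v :: "nat \<Rightarrow> real"
  assumes t: "0 \<le> t"
    and x: "\<And>i. i < n \<Longrightarrow> x i 0 = 1" "\<And>i. i < n \<Longrightarrow> x i 1 = 0"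
      "\<And>i u. i < n \<Longrightarrow> u \<ge> 2 \<Longrightarrow> \<bar>x i u\<bar> \<le> v i"
    and v: "\<And>i. i < n \<Longrightarrow> 0 \<le> v i"
  shows "(\<Sum>d\<le>D. \<bar>sum_moment x n d\<bar> * (t ^ d / fact d)) \<le> (\<Prod>i<n. 1 + v i * (exp t - 1 - t))"
  using x v
proof (induction n)
  case 0
  have "(\<Sum>d\<le>D. \<bar>0 ^ d\<bar> * (t ^ d / fact d)) = (\<Sum>d\<in>{0}. \<bar>0 ^ d\<bar> * (t ^ d / fact d))"
    by (rule sum.mono_neutral_right) auto
  then show ?case by simp
next
  case (Suc n)
  define a where "a d = \<bar>sum_moment x n d\<bar> * (t ^ d / fact d)" for d
  define b where "b d = \<bar>x n d\<bar> * (t ^ d / fact d)" for d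
  have a0: "a d \<ge> 0" for d using t by (simp add: a_def)
  have b0: "b d \<ge> 0" for d using t by (simp add: b_def)
  have IH: "(\<Sum>d\<le>D. a d) \<le> (\<Prod>i<n. 1 + v i * (exp t - 1 - t))"
    unfolding a_def by (rule Suc.IH) (use Suc.prems in auto)
  have et: "exp t - 1 - t \<ge> 0" using exp_ge_add_one_self[of t] by linarith
  have bD: "(\<Sum>d\<le>D. b d) \<le> 1 + v n * (exp t - 1 - t)"
  proof -
    have s: "(\<lambda>d. t ^ d / fact d) sums exp t"
      using exp_converges[of t] by (simp add: divide_inverse mult.commute)
    have s2: "(\<lambda>d. t ^ (d+2) / fact (d+2)) sums (exp t - (\<Sum>d<2. t ^ d / fact d))"
      using s by (subst sums_iff_shift')
    have s2': "(\<Sum>d<2. t ^ d / fact d) = 1 + t" by (simp add: numeral_2_eq_2)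
    have part: "(\<Sum>d<N. t ^ (d+2) / fact (d+2)) \<le> exp t - 1 - t" for N
      using sum_le_suminf[OF sums_summable[OF s2], of "{..<N}"] s2 s2' t
      by (auto simp: sums_iff diff_diff_eq)
    have "(\<Sum>d\<le>D. b d) \<le> (\<Sum>d<D+2. b d)"
      by (rule sum_mono2) (auto simp: b0)
    also have "\<dots> = b 0 + b 1 + (\<Sum>d<D. b (d+2))"
      by (simp add: sum.lessThan_Suc_shift del: sum.lessThan_Suc)
    also have "\<dots> = 1 + (\<Sum>d<D. b (d+2))" using Suc.prems by (simp add: b_def)
    also have "(\<Sum>d<D. b (d+2)) \<le> (\<Sum>d<D. v n * (t ^ (d+2) / fact (d+2)))"
      unfolding b_def using Suc.prems(3)[of n] t by (intro sum_mono mult_right_mono) auto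
    also have "\<dots> = v n * (\<Sum>d<D. t ^ (d+2) / fact (d+2))" by (simp add: sum_distrib_left)
    also have "\<dots> \<le> v n * (exp t - 1 - t)"
      using Suc.prems(4)[of n] part by (intro mult_left_mono) auto
    finally show ?thesis by simp
  qed
  have "(\<Sum>d\<le>D. \<bar>sum_moment x (Suc n) d\<bar> * (t ^ d / fact d)) \<le> (\<Sum>d\<le>D. \<Sum>j\<le>d. a j * b (d - j))"
  proof (rule sum_mono)
    fix d
    have "\<bar>sum_moment x (Suc n) d\<bar> \<le> (\<Sum>j\<le>d. real (d choose j) * \<bar>sum_moment x n j\<bar> * \<bar>x n (d - j)\<bar>)"
      unfolding sum_moment.simps by (rule order.trans[OF sum_abs]) (simp add: abs_mult)
    then have "\<bar>sum_moment x (Suc n) d\<bar> * (t ^ d / fact d) \<le>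
        (\<Sum>j\<le>d. real (d choose j) * \<bar>sum_moment x n j\<bar> * \<bar>x n (d - j)\<bar>) * (t ^ d / fact d)"
      using t by (intro mult_right_mono) auto
    also have "\<dots> = (\<Sum>j\<le>d. a j * b (d - j))"
      unfolding sum_distrib_right
    proof (rule sum.cong)
      fix j assume "j \<in> {..d}"
      then have j: "j \<le> d" by simp
      have "real (d choose j) * \<bar>sum_moment x n j\<bar> * \<bar>x n (d - j)\<bar> * (t ^ d / fact d) =
        (real (d choose j) * t ^ d / fact d) * (\<bar>sum_moment x n j\<bar> * \<bar>x n (d - j)\<bar>)" by simp
      then show "real (d choose j) * \<bar>sum_moment x n j\<bar> * \<bar>x n (d - j)\<bar> * (t ^ d / fact d) = a j * b (d - j)"
        unfolding weighted_choose_eq[OF j] a_def b_def by simp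
    qed simp
    finally show "\<bar>sum_moment x (Suc n) d\<bar> * (t ^ d / fact d) \<le> (\<Sum>j\<le>d. a j * b (d - j))" .
  qed
  also have "\<dots> = (\<Sum>(j,u)\<in>{(j,u). j + u \<le> D}. a j * b u)"
    by (rule sum.triangle_reindex_eq[symmetric])
  \<comment> \<open>Enlarging the triangle to the square separates the truncated Cauchy product into
    two factors.\<close>
  also have "\<dots> \<le> (\<Sum>(j,u)\<in>{..D} \<times> {..D}. a j * b u)"
    by (rule sum_mono2) (auto simp: a0 b0)
  also have "\<dots> = (\<Sum>j\<le>D. a j) * (\<Sum>u\<le>D. b u)"
    by (simp add: sum_product sum.cartesian_product)
  also have "\<dots> \<le> (\<Prod>i<n. 1 + v i * (exp t - 1 - t)) * (1 + v n * (exp t - 1 - t))"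
    using IH bD a0 b0 et Suc.prems(4)
    by (intro mult_mono) (auto intro!: sum_nonneg prod_nonneg add_nonneg_nonneg)
  finally show ?case by simp
qed

text \<open>Of the nonnegative terms of the generating function only those of order 0 and d are
  kept. The former equals 1 and produces the \<open>- 1\<close> in the bound, which keeps the
  estimate proportional to \<open>W\<close> when \<open>W\<close> is tiny.\<close>

lemma abs_sum_moment_le:
  fixes x :: "nat \<Rightarrow> nat \<Rightarrow> real" and v :: "nat \<Rightarrow> real"
  assumes t: "0 < t" and d: "0 < d"
    and x: "\<And>i. i < n \<Longrightarrow> x i 0 = 1" "\<And>i. i < n \<Longrightarrow> x i 1 = 0"
      "\<And>i u. i < n \<Longrightarrow> u \<ge> 2 \<Longrightarrow> \<bar>x i u\<bar> \<le> v i"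
    and v: "\<And>i. i < n \<Longrightarrow> 0 \<le> v i" and W: "(\<Sum>i<n. v i) \<le> W"
  shows "\<bar>sum_moment x n d\<bar> \<le> (real d / t) ^ d * (exp (W * (exp t - 1 - t)) - 1)"
proof -
  define \<phi> where "\<phi> = exp t - 1 - t"
  have \<phi>: "\<phi> \<ge> 0" using exp_ge_add_one_self[of t] unfolding \<phi>_def by linarith
  have "1 + \<bar>sum_moment x n d\<bar> * (t ^ d / fact d) = (\<Sum>j\<in>{0,d}. \<bar>sum_moment x n j\<bar> * (t ^ j / fact j))"
    using d sum_moment_0[of n x] x(1) by simp
  also have "\<dots> \<le> (\<Sum>j\<le>d. \<bar>sum_moment x n j\<bar> * (t ^ j / fact j))"
    using t by (intro sum_mono2) auto
  also have "\<dots> \<le> (\<Prod>i<n. 1 + v i * \<phi>)"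
    unfolding \<phi>_def by (rule sum_abs_sum_moment_le) (use assms in auto)
  also have "\<dots> \<le> (\<Prod>i<n. exp (v i * \<phi>))"
    using v \<phi> by (intro prod_mono) auto
  also have "\<dots> = exp ((\<Sum>i<n. v i) * \<phi>)" by (simp add: exp_sum sum_distrib_right)
  also have "\<dots> \<le> exp (W * \<phi>)" using W \<phi> by (simp add: mult_right_mono)
  finally have *: "\<bar>sum_moment x n d\<bar> * (t ^ d / fact d) \<le> exp (W * \<phi>) - 1" by simp
  have "0 \<le> \<bar>sum_moment x n d\<bar> * (t ^ d / fact d)" using t by simp
  then have e: "0 \<le> exp (W * \<phi>) - 1" using * by linarith
  have "\<bar>sum_moment x n d\<bar> = (fact d / t ^ d) * (\<bar>sum_moment x n d\<bar> * (t ^ d / fact d))"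
    using t by simp
  also have "\<dots> \<le> (fact d / t ^ d) * (exp (W * \<phi>) - 1)"
    using * t by (intro mult_left_mono) auto
  also have "\<dots> \<le> (real d ^ d / t ^ d) * (exp (W * \<phi>) - 1)"
    using t e fact_le_power[of d, where 'a = real] by (intro mult_right_mono divide_right_mono) auto
  finally show ?thesis by (simp add: \<phi>_def power_divide)
qed

section \<open>Lower bounds for sums of symmetric three-valued variables\<close>

text \<open>The moments of the law with mass \<open>q / 2\<close> at each of \<open>1\<close>, \<open>-1\<close> and mass \<open>1 - q\<close> at \<open>0\<close>.\<close>

definition sym_moment :: "real \<Rightarrow> nat \<Rightarrow> real" where
  "sym_moment q u = q / 2 * (1 + (- 1) ^ u) + (1 - q) * 0 ^ u"

lemma sym_moment_simps: "sym_moment q 0 = 1" "sym_moment q (Suc 0) = 0"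
  "even u \<Longrightarrow> u > 0 \<Longrightarrow> sym_moment q u = q"
  by (auto simp: sym_moment_def)

lemma sym_moment_nonneg: "0 \<le> q \<Longrightarrow> q \<le> 1 \<Longrightarrow> 0 \<le> sym_moment q u"
  by (cases "u = 0"; cases "even u") (auto simp: sym_moment_def)

text \<open>In the expanded power, keep the monomials in which h distinct indices occur twice each:
  there are n choose h index sets and (2h)! / 2^h orderings, and each monomial contributes q^h. All
  other terms are nonnegative.\<close>

lemma sum_moment_sym_ge_factorial:
  assumes q: "0 \<le> q" "q \<le> 1"
  shows "sum_moment (\<lambda>_. sym_moment q) n (2 * h) \<ge> fact (2 * h) / 2 ^ h * q ^ h * real (n choose h)"
proof (induction n arbitrary: h)
  case 0
  then show ?case by (cases h) auto
next
  case (Suc n)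
  let ?M = "sum_moment (\<lambda>_. sym_moment q) n"
  have nn: "?M j \<ge> 0" for j by (rule sum_moment_nonneg) (use q sym_moment_nonneg in auto)
  show ?case
  proof (cases h)
    case 0
    then show ?thesis by (simp add: sum_moment_0 sym_moment_simps)
  next
    case h: (Suc g)
    let ?f = "\<lambda>j. real (2 * h choose j) * ?M j * sym_moment q (2 * h - j)"
    have "fact (2 * h) = (fact (2 * g) :: real) * (2 * h) * (2 * h - 1)"
      using h by (simp add: field_simps)
    moreover have "real (2 * h choose (2 * g)) = real h * (2 * h - 1)"
    proof -
      have "2 * h choose (2 * g) = 2 * h choose 2"
        using binomial_symmetric[of 2 "2 * h"] h by simp
      also have "\<dots> = h * (2 * h - 1)" by (simp add: choose_two)
      finally show ?thesis using h by (simp add: of_nat_diff algebra_simps)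
    qed
    ultimately have F: "real (2 * h choose (2 * g)) * (fact (2 * g) / 2 ^ g) = fact (2 * h) / 2 ^ h"
      using h by (simp add: field_simps)
    \<comment> \<open>Pascal's rule: the last index occurs twice or not at all.\<close>
    have "fact (2 * h) / 2 ^ h * q ^ h * real (Suc n choose h) =
        real (2 * h choose (2 * g)) * (fact (2 * g) / 2 ^ g * q ^ g * real (n choose g)) * q
         + fact (2 * h) / 2 ^ h * q ^ h * real (n choose h)"
      unfolding F[symmetric] using h by (simp add: algebra_simps add_divide_distrib)
    also have "\<dots> \<le> real (2 * h choose (2 * g)) * ?M (2 * g) * q + ?M (2 * h)"
      using Suc.IH[of g] Suc.IH[of h] q by (intro add_mono mult_left_mono mult_right_mono) auto
    also have "\<dots> = (\<Sum>j\<in>{2 * g, 2 * h}. ?f j)"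
      using h by (simp add: sym_moment_simps numeral_2_eq_2[symmetric])
    also have "\<dots> \<le> (\<Sum>j\<le>2 * h. ?f j)"
      using h q nn sym_moment_nonneg by (intro sum_mono2) (auto intro!: mult_nonneg_nonneg)
    finally show ?thesis by simp
  qed
qed

text \<open>These are the diagonal terms: each single summand contributes its own d-th moment
  q.\<close>

lemma sum_moment_sym_ge_linear:
  assumes q: "0 \<le> q" "q \<le> 1" and d: "even d" "d > 0"
  shows "sum_moment (\<lambda>_. sym_moment q) n d \<ge> real n * q"
proof (induction n)
  case 0
  then show ?case by simp
next
  case (Suc n)
  let ?M = "sum_moment (\<lambda>_. sym_moment q) n"
  let ?f = "\<lambda>j. real (d choose j) * ?M j * sym_moment q (d - j)"
  have nn: "?M j \<ge> 0" for j by (rule sum_moment_nonneg) (use q sym_moment_nonneg in auto)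
  have "real (Suc n) * q \<le> ?M d + q" using Suc by (simp add: algebra_simps)
  also have "\<dots> = (\<Sum>j\<in>{0, d}. ?f j)"
    using d by (simp add: sym_moment_simps sum_moment_0)
  also have "\<dots> \<le> (\<Sum>j\<le>d. ?f j)"
    using q nn sym_moment_nonneg by (intro sum_mono2) (auto intro!: mult_nonneg_nonneg)
  finally show ?case by simp
qed

definition egf :: "(nat \<Rightarrow> real) \<Rightarrow> real fps" where
  "egf f = Abs_fps (\<lambda>u. f u / fact u)"

lemma egf_sum_moment_Suc: "egf (sum_moment x (Suc n)) = egf (sum_moment x n) * egf (x n)"
proof (rule fps_ext)
  fix d
  have "fps_nth (egf (sum_moment x (Suc n))) d
      = (\<Sum>j\<le>d. real (d choose j) * 1 ^ d / fact d * (sum_moment x n j * x n (d - j)))"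
    by (simp add: egf_def sum_divide_distrib mult_ac)
  also have "\<dots> = (\<Sum>j\<le>d. sum_moment x n j / fact j * (x n (d - j) / fact (d - j)))"
    by (rule sum.cong) (simp_all only: weighted_choose_eq atMost_iff, simp)
  finally show "fps_nth (egf (sum_moment x (Suc n))) d = fps_nth (egf (sum_moment x n) * egf (x n)) d"
    by (simp add: fps_mult_nth egf_def atLeast0AtMost)
qed

lemma egf_sum_moment_0: "egf (sum_moment x 0) = 1"
  by (rule fps_ext) (auto simp: egf_def)

lemma egf_sym_moment:
  "egf (sym_moment q) = fps_const (q / 2) * (fps_exp 1 + fps_exp (- 1)) + fps_const (1 - q)"
proof (rule fps_ext)
  fix u
  show "fps_nth (egf (sym_moment q)) u
      = fps_nth (fps_const (q / 2) * (fps_exp 1 + fps_exp (- 1)) + fps_const (1 - q)) u"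
    by (cases "u = 0") (simp_all add: egf_def sym_moment_def field_simps)
qed

text \<open>The parameter \<open>a\<close> makes the induction work: conditioning on one summand shifts \<open>a\<close>.\<close>

lemma shifted_sum_moment_sym_ge:
  assumes q: "0 \<le> q" "q \<le> 1" and d: "even d"
  shows "fact d * fps_nth (egf (sum_moment (\<lambda>_. sym_moment q) n) * fps_exp a) d
    \<ge> real (n choose l) * (q / 2) ^ l * (1 - q) ^ (n - l) * (a + real l) ^ d"
proof (induction n arbitrary: a l)
  case 0
  then show ?case using d by (cases l) (auto simp: egf_sum_moment_0 simp del: sum_moment.simps)
next
  case (Suc n)
  \<comment> \<open>\<open>A a\<close> is the d-th moment of a plus the sum of n such summands;
    \<open>B a l\<close> is the share of the event that exactly l of them are 1 and the others
    0.\<close>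
  define A where "A a = fact d * fps_nth (egf (sum_moment (\<lambda>_. sym_moment q) n) * fps_exp a) d" for a
  define B where "B a l = real (n choose l) * (q / 2) ^ l * (1 - q) ^ (n - l) * (a + real l) ^ d"
    for a :: real and l
  have AB: "B a l \<le> A a" for a l unfolding A_def B_def by (rule Suc.IH)
  have B0: "0 \<le> B a l" for a l
    unfolding B_def using q zero_le_even_power[OF d, of "a + real l"] by simp
  have A0: "0 \<le> A a" for a using AB[of a 0] B0[of a 0] by linarith
  have "egf (sum_moment (\<lambda>_. sym_moment q) (Suc n)) * fps_exp a
      = fps_const (q / 2) * (egf (sum_moment (\<lambda>_. sym_moment q) n) * fps_exp (a + 1)
          + egf (sum_moment (\<lambda>_. sym_moment q) n) * fps_exp (a + (- 1)))
        + fps_const (1 - q) * (egf (sum_moment (\<lambda>_. sym_moment q) n) * fps_exp a)"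
    unfolding egf_sum_moment_Suc egf_sym_moment fps_exp_add_mult by (simp only: algebra_simps)
  then have eq: "fact d * fps_nth (egf (sum_moment (\<lambda>_. sym_moment q) (Suc n)) * fps_exp a) d
      = q / 2 * (A (a + 1) + A (a - 1)) + (1 - q) * A a"
    by (simp only: A_def fps_add_nth fps_mult_left_const_nth diff_conv_add_uminus)
      (simp add: algebra_simps)
  \<comment> \<open>The value -1 of the last summand is dropped: as d is even, its contribution is
    nonnegative.\<close>
  have *: "q / 2 * A (a + 1) + (1 - q) * A a
      \<le> fact d * fps_nth (egf (sum_moment (\<lambda>_. sym_moment q) (Suc n)) * fps_exp a) d"
    unfolding eq using q A0[of "a - 1"] by (simp add: algebra_simps)
  have "real (Suc n choose l) * (q / 2) ^ l * (1 - q) ^ (Suc n - l) * (a + real l) ^ d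
      \<le> q / 2 * A (a + 1) + (1 - q) * A a"
  proof (cases l)
    case 0
    have "real (Suc n choose l) * (q / 2) ^ l * (1 - q) ^ (Suc n - l) * (a + real l) ^ d
        = (1 - q) * B a 0" using 0 by (simp add: B_def)
    also have "\<dots> \<le> (1 - q) * A a" using AB q by (intro mult_left_mono) auto
    finally show ?thesis using q A0[of "a + 1"] by (smt (verit) mult_nonneg_nonneg divide_nonneg_nonneg)
  next
    case l: (Suc g)
    \<comment> \<open>Pascal's rule, according to whether the last summand is 1 or 0. For l > n the
      second alternative vanishes with its binomial coefficient.\<close>
    have "real (Suc n choose l) * (q / 2) ^ l * (1 - q) ^ (Suc n - l) * (a + real l) ^ d
        = q / 2 * B (a + 1) g + (1 - q) * B a l"
    proof (cases "l \<le> n")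
      case True
      then have "Suc n - l = Suc (n - l)" "n - g = Suc (n - l)" using l by auto
      then show ?thesis
        using l unfolding B_def by (simp add: algebra_simps add_divide_distrib diff_divide_distrib)
    next
      case False
      then have "n choose l = 0" "n - g = 0" "Suc n - l = 0" using l by auto
      then show ?thesis using l unfolding B_def by (simp add: algebra_simps)
    qed
    also have "\<dots> \<le> q / 2 * A (a + 1) + (1 - q) * A a"
      using AB q by (intro add_mono mult_left_mono) auto
    finally show ?thesis .
  qed
  with * show ?case by linarith
qed

lemma sum_moment_sym_ge_binomial:
  assumes "0 \<le> q" "q \<le> 1" "even d"
  shows "sum_moment (\<lambda>_. sym_moment q) n d
    \<ge> real (n choose l) * (q / 2) ^ l * (1 - q) ^ (n - l) * real l ^ d"
  using shifted_sum_moment_sym_ge[OF assms, of n l 0] by (simp add: egf_def)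

section \<open>Realising moments by random variables\<close>

lemma kwise_indep_measurable:
  assumes "prob_space P" "kwise_indep P n k X" "k \<ge> 1" "i < n"
  shows "X i \<in> borel_measurable P"
proof -
  interpret prob_space P by fact
  have "indep_vars (\<lambda>_. borel) X {i}"
    using assms by (auto simp: kwise_indep_def)
  then show ?thesis by (auto simp: indep_vars_def)
qed

text \<open>Every monomial of degree d involves at most d \<le> k distinct variables, so k-wise
  independence suffices to factorise its expectation. Boundedness supplies the
  integrability.\<close>

lemma integral_sum_power:
  fixes X :: "nat \<Rightarrow> 'a \<Rightarrow> real"
  assumes P: "prob_space P" and ind: "kwise_indep P n k X" and k: "k \<ge> 1"
    and bd: "\<And>i. i < n \<Longrightarrow> AE \<omega> in P. \<bar>X i \<omega>\<bar> \<le> 1" and d: "d \<le> k"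
  shows "mean P (\<lambda>\<omega>. (\<Sum>i<n. X i \<omega>) ^ d) = sum_moment (\<lambda>i u. mean P (\<lambda>\<omega>. X i \<omega> ^ u)) n d"
proof -
  interpret prob_space P by fact
  define x where "x i u = mean P (\<lambda>\<omega>. X i \<omega> ^ u)" for i u
  have X [measurable]: "X i \<in> borel_measurable P" if "i < n" for i
    using kwise_indep_measurable[OF P ind k that] .
  have Xbd: "AE \<omega> in P. \<forall>i<n. \<bar>X i \<omega>\<bar> \<le> 1"
    using bd by (subst AE_all_countable) (auto simp: AE_impI)
  have int: "integrable P (\<lambda>\<omega>. (\<Sum>i<m. X i \<omega>) ^ t * (\<Prod>i\<in>{m..<n}. X i \<omega> ^ a i))"
    if "m \<le> n" for m t a
  proof (rule integrable_const_bound[where B = "real m ^ t"])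
    show "AE \<omega> in P. norm ((\<Sum>i<m. X i \<omega>) ^ t * (\<Prod>i\<in>{m..<n}. X i \<omega> ^ a i)) \<le> real m ^ t"
      using Xbd
    proof eventually_elim
      case (elim \<omega>)
      have "\<bar>\<Sum>i<m. X i \<omega>\<bar> \<le> (\<Sum>i<m. 1)"
        using elim that by (intro order.trans[OF sum_abs] sum_mono) auto
      then have 1: "\<bar>\<Sum>i<m. X i \<omega>\<bar> ^ t \<le> real m ^ t" by (intro power_mono) auto
      have 2: "\<bar>\<Prod>i\<in>{m..<n}. X i \<omega> ^ a i\<bar> \<le> 1"
        unfolding abs_prod power_abs using elim by (intro prod_le_1) (auto intro: power_le_one)
      show ?case
        using mult_mono[OF 1 2] by (simp add: abs_mult power_abs)
    qed
    show "(\<lambda>\<omega>. (\<Sum>i<m. X i \<omega>) ^ t * (\<Prod>i\<in>{m..<n}. X i \<omega> ^ a i)) \<in> borel_measurable P"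
      using that by (intro borel_measurable_times borel_measurable_power borel_measurable_sum
        borel_measurable_prod X) auto
  qed
  \<comment> \<open>Expanding one summand at a time keeps the number of distinct factors within \<open>k\<close>.\<close>
  have "mean P (\<lambda>\<omega>. (\<Sum>i<m. X i \<omega>) ^ t * (\<Prod>i\<in>{m..<n}. X i \<omega> ^ a i))
      = sum_moment x m t * (\<Prod>i\<in>{m..<n}. x i (a i))"
    if "m \<le> n" "card {i\<in>{m..<n}. a i \<noteq> 0} + t \<le> k" for m t a
    using that
  proof (induction m arbitrary: t a)
    case 0
    show ?case
    proof (cases "t = 0")
      case True
      \<comment> \<open>Indices with exponent 0 contribute the factor 1, so independence is invoked
        only on \<open>J\<close>, which has at most k elements.\<close>
      define J where "J = {i\<in>{0..<n}. a i \<noteq> 0}"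
      have J: "J \<subseteq> {..<n}" "card J \<le> k" using 0 True by (auto simp: J_def)
      have iv: "indep_vars (\<lambda>_. borel) (\<lambda>i \<omega>. X i \<omega> ^ a i) J"
        by (rule indep_vars_compose2[of "\<lambda>_. borel" X J "\<lambda>i y. y ^ a i" "\<lambda>_. borel"])
          (use ind J in \<open>simp_all add: kwise_indep_def\<close>)
      have "mean P (\<lambda>\<omega>. \<Prod>i\<in>{0..<n}. X i \<omega> ^ a i) = mean P (\<lambda>\<omega>. \<Prod>i\<in>J. X i \<omega> ^ a i)"
        by (intro arg_cong[where f = "integral\<^sup>L P"] ext prod.mono_neutral_right) (auto simp: J_def)
      also have "\<dots> = (\<Prod>i\<in>J. x i (a i))"
        unfolding x_def
      proof (rule indep_vars_lebesgue_integral[OF _ iv])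
        fix i assume "i \<in> J"
        then have i: "i < n" using J by auto
        show "integrable P (\<lambda>\<omega>. X i \<omega> ^ a i)"
        proof (rule integrable_const_bound[where B = 1])
          show "AE \<omega> in P. norm (X i \<omega> ^ a i) \<le> 1"
            using bd[OF i] by eventually_elim (auto simp: power_abs intro: power_le_one)
        qed (use i in measurable)
      qed (use J finite_subset in blast)
      also have "\<dots> = (\<Prod>i\<in>{0..<n}. x i (a i))"
        by (intro prod.mono_neutral_left) (auto simp: J_def x_def prob_space)
      finally show ?thesis using True by simp
    qed simp
  next
    case (Suc m)
    then have m: "m < n" by simp
    \<comment> \<open>The binomial theorem splits off \<open>X m\<close>, which receives the
      exponent t - j.\<close>
    define b where "b j = a(m := t - j)" for j
    have split: "{m..<n} = insert m {Suc m..<n}" using m by auto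
    have "(\<Sum>i<Suc m. X i \<omega>) ^ t * (\<Prod>i\<in>{Suc m..<n}. X i \<omega> ^ a i)
        = (\<Sum>j\<le>t. real (t choose j) * ((\<Sum>i<m. X i \<omega>) ^ j * (\<Prod>i\<in>{m..<n}. X i \<omega> ^ b j i)))" for \<omega>
    proof -
      have "(\<Prod>i\<in>{m..<n}. X i \<omega> ^ b j i) = X m \<omega> ^ (t - j) * (\<Prod>i\<in>{Suc m..<n}. X i \<omega> ^ a i)" for j
        unfolding split by (auto simp: b_def intro!: prod.cong)
      then show ?thesis
        by (simp add: binomial_ring sum_distrib_left sum_distrib_right mult_ac)
    qed
    then have "mean P (\<lambda>\<omega>. (\<Sum>i<Suc m. X i \<omega>) ^ t * (\<Prod>i\<in>{Suc m..<n}. X i \<omega> ^ a i))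
        = (\<Sum>j\<le>t. real (t choose j) *
            mean P (\<lambda>\<omega>. (\<Sum>i<m. X i \<omega>) ^ j * (\<Prod>i\<in>{m..<n}. X i \<omega> ^ b j i)))"
      using m by (simp add: int)
    also have "\<dots> = (\<Sum>j\<le>t. real (t choose j) * (sum_moment x m j * (\<Prod>i\<in>{m..<n}. x i (b j i))))"
    proof (intro sum.cong refl arg_cong2[where f = "(*)"] Suc.IH)
      fix j assume j: "j \<in> {..t}"
      have c: "card {i\<in>{Suc m..<n}. a i \<noteq> 0} + t \<le> k" using Suc.prems by simp
      \<comment> \<open>Either j = t and m stays out of the product, or m enters it while the
        remaining degree drops by at least one; the budget k holds in both cases.\<close>
      show "card {i\<in>{m..<n}. b j i \<noteq> 0} + j \<le> k"
      proof (cases "j = t")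
        case True
        then have "{i\<in>{m..<n}. b j i \<noteq> 0} = {i\<in>{Suc m..<n}. a i \<noteq> 0}"
          unfolding split by (auto simp: b_def)
        then show ?thesis using c True by simp
      next
        case False
        then have "{i\<in>{m..<n}. b j i \<noteq> 0} = insert m {i\<in>{Suc m..<n}. a i \<noteq> 0}"
          using j unfolding split by (auto simp: b_def)
        then show ?thesis using c False j by simp
      qed
    qed (use m in simp)
    also have "\<dots> = sum_moment x (Suc m) t * (\<Prod>i\<in>{Suc m..<n}. x i (a i))"
    proof -
      have "(\<Prod>i\<in>{m..<n}. x i (b j i)) = x m (t - j) * (\<Prod>i\<in>{Suc m..<n}. x i (a i))" for j
        unfolding split by (auto simp: b_def intro!: prod.cong)
      then show ?thesis by (simp add: sum_distrib_left sum_distrib_right mult_ac)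
    qed
    finally show ?case .
  qed
  from this[of n "\<lambda>_. 0" d] show ?thesis using d by (simp add: x_def[abs_def])
qed

section \<open>Independent variables with prescribed laws\<close>

lemma prob_space_with_laws:
  assumes N: "\<And>i. i < n \<Longrightarrow> real_distribution (N i)"
  obtains Q :: "(nat \<Rightarrow> real) measure" and X where
    "prob_space Q" "\<And>k. kwise_indep Q n k X" "\<And>i. i < n \<Longrightarrow> distr Q borel (X i) = N i"
proof -
  define Q where "Q = PiM {..<n} N"
  define X :: "nat \<Rightarrow> (nat \<Rightarrow> real) \<Rightarrow> real" where "X i \<omega> = \<omega> i" for i \<omega>
  have sN [simp]: "sets (N i) = sets borel" and pN: "prob_space (N i)" if "i < n" for i
    using N[OF that] by (auto simp: real_distribution_def real_distribution_axioms_def)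
  interpret Q: prob_space Q unfolding Q_def by (rule prob_space_PiM) (auto intro: pN)
  have X [measurable]: "X i \<in> borel_measurable Q" if "i < n" for i
  proof -
    have "X i \<in> measurable Q (N i)"
      using that unfolding Q_def X_def[abs_def] by (intro measurable_component_singleton) auto
    also have "measurable Q (N i) = borel_measurable Q"
      using that by (intro measurable_cong_sets) auto
    finally show ?thesis .
  qed
  have d: "distr Q borel (X i) = N i" if "i < n" for i
  proof -
    have "distr Q borel (X i) = distr Q (N i) (\<lambda>\<omega>. \<omega> i)"
      using that by (intro distr_cong) (auto simp: X_def)
    then show ?thesis using that distr_PiM_component[of "{..<n}" N i] pN by (simp add: Q_def)
  qed
  have "Q.indep_vars (\<lambda>_. borel) X J" if J: "J \<subseteq> {..<n}" for J
  proof (cases "J = {}")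
    case True
    then show ?thesis by (simp add: Q.indep_vars_def Q.indep_sets_def)
  next
    case False
    have lt: "i < n" if "i \<in> J" for i using that J by auto
    have "distr Q (\<Pi>\<^sub>M i\<in>J. borel) (\<lambda>x. \<lambda>i\<in>J. X i x) = distr Q (PiM J N) (\<lambda>\<omega>. \<lambda>i\<in>J. \<omega> i)"
      using lt by (intro distr_cong sets_PiM_cong) (auto simp: X_def)
    also have "\<dots> = PiM J N"
      unfolding Q_def using distr_PiM_reindex[of "{..<n}" N "\<lambda>i. i" J] J pN by auto
    also have "\<dots> = (\<Pi>\<^sub>M i\<in>J. distr Q borel (X i))"
      using lt d by (intro PiM_cong) auto
    finally show ?thesis
      using False lt by (subst Q.indep_vars_iff_distr_eq_PiM') auto
  qed
  then have "kwise_indep Q n k X" for k by (auto simp: kwise_indep_def)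
  then show ?thesis using that[of Q X] d Q.prob_space_axioms by blast
qed

section \<open>Compactness of the centred laws on [-1, 1]\<close>

definition unit_law :: "real measure \<Rightarrow> bool" where
  "unit_law \<mu> \<longleftrightarrow> real_distribution \<mu> \<and> (AE x in \<mu>. \<bar>x\<bar> \<le> 1) \<and> integral\<^sup>L \<mu> (\<lambda>x. x) = 0"

abbreviation law_moment :: "real measure \<Rightarrow> nat \<Rightarrow> real" where
  "law_moment \<mu> u \<equiv> integral\<^sup>L \<mu> (\<lambda>x. x ^ u)"

lemma unit_law_integrable:
  assumes "unit_law \<mu>"
  shows "integrable \<mu> (\<lambda>x. x ^ u)"
proof -
  interpret real_distribution \<mu> using assms by (simp add: unit_law_def)
  have "AE x in \<mu>. \<bar>x\<bar> \<le> 1" using assms by (simp add: unit_law_def)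
  then have "AE x in \<mu>. norm (x ^ u) \<le> 1"
    by eventually_elim (auto simp: power_abs intro: power_le_one)
  then show ?thesis by (rule integrable_const_bound) measurable
qed

lemma unit_law_moments:
  assumes \<mu>: "unit_law \<mu>"
  shows "law_moment \<mu> 0 = 1" "law_moment \<mu> 1 = 0" "0 \<le> law_moment \<mu> 2"
    "u \<ge> 2 \<Longrightarrow> \<bar>law_moment \<mu> u\<bar> \<le> law_moment \<mu> 2" "\<bar>law_moment \<mu> u\<bar> \<le> 1"
proof -
  interpret real_distribution \<mu> using assms by (simp add: unit_law_def)
  have b: "AE x in \<mu>. \<bar>x\<bar> \<le> 1" using assms by (simp add: unit_law_def)
  show *: "law_moment \<mu> 0 = 1" using prob_space by simp
  show "law_moment \<mu> 1 = 0" using assms by (simp add: unit_law_def)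
  show "0 \<le> law_moment \<mu> 2" by simp
  have mono: "\<bar>law_moment \<mu> u\<bar> \<le> law_moment \<mu> w" if "w \<le> u" "even w" for u w
  proof -
    have "\<bar>law_moment \<mu> u\<bar> \<le> (\<integral>x. \<bar>x ^ u\<bar> \<partial>\<mu>)" by (rule integral_abs_bound)
    also have "\<dots> \<le> law_moment \<mu> w"
    proof (rule integral_mono_AE)
      show "AE x in \<mu>. \<bar>x ^ u\<bar> \<le> x ^ w"
        using b
      proof eventually_elim
        case (elim x)
        have "\<bar>x\<bar> ^ u \<le> \<bar>x\<bar> ^ w" using elim that by (intro power_decreasing) auto
        then show ?case using that by (simp add: power_abs power_even_abs)
      qed
    qed (use unit_law_integrable[OF \<mu>] in auto)
    finally show ?thesis .
  qed
  show "u \<ge> 2 \<Longrightarrow> \<bar>law_moment \<mu> u\<bar> \<le> law_moment \<mu> 2" using mono[of 2 u] by simp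
  show "\<bar>law_moment \<mu> u\<bar> \<le> 1" using mono[of 0 u] * by simp
qed

text \<open>Laws carried by a fixed bounded interval are tight, so Helly's theorem gives a weak
  limit. Support, mean and all moments pass to the limit because bounded continuous functions can
  test them.\<close>

lemma unit_law_subseq:
  assumes \<mu>: "\<And>j. unit_law (\<mu> j)"
  obtains r :: "nat \<Rightarrow> nat" and \<nu> where "strict_mono r" "unit_law \<nu>"
    "\<And>u. (\<lambda>j. law_moment (\<mu> (r j)) u) \<longlonglongrightarrow> law_moment \<nu> u"
proof -
  have rd: "real_distribution (\<mu> j)" and b: "AE x in \<mu> j. \<bar>x\<bar> \<le> 1" for j
    using \<mu>[of j] by (auto simp: unit_law_def)
  \<comment> \<open>Tightness is phrased with half-open intervals; the left end is -2 so that the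
    point -1 lies inside.\<close>
  have "measure (\<mu> j) {-2<..1} = 1" for j
  proof -
    interpret real_distribution "\<mu> j" by (rule rd)
    have "AE x in \<mu> j. x \<in> {-2<..1}" using b[of j] by eventually_elim auto
    then show ?thesis by (subst prob_eq_1) auto
  qed
  then have "tight \<mu>"
    unfolding tight_def using rd by (intro conjI allI impI exI[of _ "-2"] exI[of _ 1]) auto
  from tight_imp_convergent_subsubsequence[OF this strict_mono_id]
  obtain r \<nu> where r: "strict_mono r" and \<nu>: "real_distribution \<nu>" and w: "weak_conv_m (\<lambda>j. \<mu> (r j)) \<nu>"
    by (auto simp: comp_def)
  have conv: "(\<lambda>j. integral\<^sup>L (\<mu> (r j)) f) \<longlonglongrightarrow> integral\<^sup>L \<nu> f"
    if "\<And>x. isCont f x" "\<And>x. norm (f x) \<le> 1" for f :: "real \<Rightarrow> real"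
    by (rule weak_conv_imp_integral_bdd_continuous_conv[of _ _ f 1]) (use rd \<nu> w that in auto)
  interpret \<nu>: real_distribution \<nu> by (rule \<nu>)
  have \<nu>b: "AE x in \<nu>. \<bar>x\<bar> \<le> 1"
  proof -
    \<comment> \<open>A bounded continuous test function that vanishes precisely on [-1, 1].\<close>
    define g :: "real \<Rightarrow> real" where "g x = min 1 (max 0 (\<bar>x\<bar> - 1))" for x
    have gm [measurable]: "g \<in> borel_measurable borel" unfolding g_def by measurable
    have g: "0 \<le> g x" "g x \<le> 1" for x by (auto simp: g_def)
    have "integral\<^sup>L (\<mu> j) g = 0" for j
    proof -
      have "AE x in \<mu> j. g x = 0" using b[of j] by eventually_elim (auto simp: g_def)
      then show ?thesis by (rule integral_eq_zero_AE)
    qed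
    moreover have "(\<lambda>j. integral\<^sup>L (\<mu> (r j)) g) \<longlonglongrightarrow> integral\<^sup>L \<nu> g"
      by (rule conv) (use g in \<open>auto simp: g_def[abs_def] intro!: continuous_intros\<close>)
    ultimately have "integral\<^sup>L \<nu> g = 0" by (simp add: LIMSEQ_const_iff)
    moreover have "integrable \<nu> g"
      by (rule \<nu>.integrable_const_bound[of _ 1]) (use g in auto)
    ultimately have "AE x in \<nu>. g x = 0"
      using integral_nonneg_eq_0_iff_AE[of \<nu> g] g by auto
    then show ?thesis by eventually_elim (auto simp: g_def split: if_splits)
  qed
  \<comment> \<open>Powers are unbounded on the line; clamping to [-1, 1] makes them bounded and
    changes nothing almost everywhere.\<close>
  define c :: "real \<Rightarrow> real" where "c x = max (-1) (min 1 x)" for x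
  have cm [measurable]: "c \<in> borel_measurable borel" unfolding c_def by measurable
  have c: "law_moment \<kappa> u = integral\<^sup>L \<kappa> (\<lambda>x. c x ^ u)"
    if "real_distribution \<kappa>" "AE x in \<kappa>. \<bar>x\<bar> \<le> 1" for \<kappa> u
  proof -
    interpret real_distribution \<kappa> by fact
    have "AE x in \<kappa>. x ^ u = c x ^ u" using that(2) by eventually_elim (auto simp: c_def)
    then show ?thesis by (intro integral_cong_AE) auto
  qed
  have m: "(\<lambda>j. law_moment (\<mu> (r j)) u) \<longlonglongrightarrow> law_moment \<nu> u" for u
    unfolding c[OF rd b] c[OF \<nu> \<nu>b]
    by (rule conv) (auto simp: c_def power_abs intro!: continuous_intros power_le_one)
  have "law_moment \<nu> 1 = 0"
    using m[of 1] unit_law_moments(2)[OF \<mu>] by (simp add: LIMSEQ_const_iff)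
  then have "unit_law \<nu>" using \<nu> \<nu>b by (simp add: unit_law_def)
  then show ?thesis using that r m by blast
qed

text \<open>One extraction per coordinate; limits already obtained persist along further
  subsequences.\<close>

lemma unit_laws_subseq:
  fixes n :: nat
  assumes "\<And>i j. i < n \<Longrightarrow> unit_law (\<mu> j i)"
  shows "\<exists>(r :: nat \<Rightarrow> nat) \<nu>. strict_mono r \<and> (\<forall>i<n. unit_law (\<nu> i) \<and>
    (\<forall>u. (\<lambda>j. law_moment (\<mu> (r j) i) u) \<longlonglongrightarrow> law_moment (\<nu> i) u))"
  using assms
proof (induction n)
  case 0
  then show ?case by (auto intro: exI[of _ id] strict_mono_id)
next
  case (Suc n)
  then obtain r :: "nat \<Rightarrow> nat" and \<nu> where r: "strict_mono r"
    and \<nu>: "\<And>i. i < n \<Longrightarrow> unit_law (\<nu> i)"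
      "\<And>i u. i < n \<Longrightarrow> (\<lambda>j. law_moment (\<mu> (r j) i) u) \<longlonglongrightarrow> law_moment (\<nu> i) u"
    by (metis less_SucI)
  obtain s :: "nat \<Rightarrow> nat" and \<rho> where s: "strict_mono s" and \<rho>: "unit_law \<rho>"
      "\<And>u. (\<lambda>j. law_moment (\<mu> (r (s j)) n) u) \<longlonglongrightarrow> law_moment \<rho> u"
    using unit_law_subseq[of "\<lambda>j. \<mu> (r j) n"] Suc.prems by auto
  have "(\<lambda>j. law_moment (\<mu> (r (s j)) i) u) \<longlonglongrightarrow> law_moment (\<nu> i) u" if "i < n" for i u
    using LIMSEQ_subseq_LIMSEQ[OF \<nu>(2)[OF that] s] by (simp add: comp_def)
  then show ?case
    using strict_mono_o[OF r s, unfolded comp_def] \<nu> \<rho>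
    by (intro exI[of _ "\<lambda>j. r (s j)"] exI[of _ "\<nu>(n := \<rho>)"]) (auto simp: less_Suc_eq)
qed

section \<open>Comparison with the rate\<close>

lemma powr_inverse_le_iff:
  fixes E B :: real
  assumes "d > 0" "0 \<le> E" "0 \<le> B"
  shows "E powr (1 / real d) \<le> B \<longleftrightarrow> E \<le> B ^ d"
    and "B \<le> E powr (1 / real d) \<longleftrightarrow> B ^ d \<le> E"
proof -
  have e: "(E powr (1 / real d)) ^ d = E"
    using assms by (cases "E = 0") (simp_all add: powr_realpow[symmetric] powr_powr)
  show "E powr (1 / real d) \<le> B \<longleftrightarrow> E \<le> B ^ d" "B \<le> E powr (1 / real d) \<longleftrightarrow> B ^ d \<le> E"
    using power_mono_iff[of "E powr (1 / real d)" B d] power_mono_iff[of B "E powr (1 / real d)" d]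
      assms e by auto
qed

text \<open>Write L = ln (d / (n s2)). Outside the range 2 \<le> L < d / n, the first case of the
  rate amounts to L < 2, and this is what permits a choice of t below 1.\<close>

lemma rate_upper_bound:
  fixes n d :: nat and s2 E :: real
  assumes n: "n \<ge> 1" and d: "d > 0" and s2: "s2 > 0" and E: "0 \<le> E"
    and bound: "\<And>t. t > 0 \<Longrightarrow>
      E \<le> (real d / t) ^ d * (exp (real n * s2 * (exp t - 1 - t)) - 1)"
    and regime: "\<not> (2 \<le> ln (real d / (real n * s2)) \<and> ln (real d / (real n * s2)) < real d / real n)"
  shows "E powr (1 / real d) \<le> exp 2 * moment_rate n s2 d"
proof -
  define W where "W = real n * s2"
  define L where "L = ln (real d / W)"
  have W: "W > 0" using n s2 by (simp add: W_def)
  have eL: "exp L = real d / W" using W d by (simp add: L_def)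
  note defs = moment_rate_def Let_def W_def[symmetric] mult.assoc L_def[symmetric]
  have bd: "E \<le> (real d / t) ^ d * (exp (W * (exp t - 1 - t)) - 1)" if "t > 0" for t
    using bound[OF that] by (simp add: W_def)
  consider "L < 2" | "2 \<le> L" "real d / real n \<le> L" "L \<le> real d" | "2 \<le> L" "real d / real n \<le> L" "real d < L"
    using regime unfolding W_def[symmetric] L_def[symmetric] by linarith
  then show ?thesis
  proof cases
    case 1
    \<comment> \<open>Division by e makes t \<le> 1, since d / W = e^L < e^2. For such t the
      function e^t - 1 - t is at most t^2, and W t^2 \<le> d.\<close>
    define t where "t = sqrt (real d / W) / exp 1"
    have t0: "t > 0" using W d by (simp add: t_def)
    have "sqrt (real d / W) \<le> sqrt (exp 2)"
      using 1 unfolding eL[symmetric] by (intro real_sqrt_le_mono) simp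
    also have "sqrt (exp 2) = exp (1 :: real)"
      by (rule real_sqrt_unique) (simp_all add: power2_eq_square flip: exp_add)
    finally have t1: "t \<le> 1" by (simp add: t_def)
    have t2: "W * t\<^sup>2 \<le> real d"
    proof -
      have "W * t\<^sup>2 = real d / (exp 1)\<^sup>2" using W by (simp add: t_def power_divide)
      also have "\<dots> \<le> real d / 1" by (intro divide_left_mono) (auto simp: one_le_power)
      finally show ?thesis by simp
    qed
    have "W * (exp t - 1 - t) \<le> W * t\<^sup>2"
      using exp_bound[of t] t0 t1 W by (intro mult_left_mono) auto
    then have "exp (W * (exp t - 1 - t)) - 1 \<le> exp (real d * 1)" using t2
      by (smt (verit) exp_le_cancel_iff mult_cancel_left2)
    then have "E \<le> (real d / t) ^ d * exp 1 ^ d"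
      using bd[OF t0] t0 unfolding exp_of_nat_mult
      by (smt (verit) mult_left_mono zero_le_power divide_nonneg_pos of_nat_0_le_iff)
    also have "\<dots> = (exp 1 * exp 1 * (real d / sqrt (real d / W))) ^ d"
      unfolding power_mult_distrib[symmetric] by (simp add: t_def mult_ac)
    also have "real d / sqrt (real d / W) = sqrt (real d * W)"
      using W d by (simp add: real_sqrt_divide real_sqrt_mult field_simps)
    finally have "E powr (1 / real d) \<le> exp 1 * exp 1 * sqrt (real d * W)"
      using E W d by (subst powr_inverse_le_iff) auto
    moreover have "moment_rate n s2 d = sqrt (real d * W)"
      using 1 by (auto simp: defs)
    ultimately show ?thesis by (simp flip: exp_add)
  next
    case 2
    \<comment> \<open>For t = L the product W e^t equals d, so the exponential factor is at most
      e^d.\<close>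
    have "W * (exp L - 1 - L) \<le> W * exp L" using 2 W by (intro mult_left_mono) auto
    also have "\<dots> = real d * 1" unfolding eL using W by simp
    finally have "exp (W * (exp L - 1 - L)) - 1 \<le> exp (real d * 1)"
      by (smt (verit) exp_le_cancel_iff)
    then have "E \<le> (real d / L) ^ d * exp 1 ^ d"
      using bd[of L] 2 unfolding exp_of_nat_mult
      by (smt (verit) mult_left_mono zero_le_power divide_nonneg_pos of_nat_0_le_iff)
    then have "E \<le> (exp 1 * (real d / L)) ^ d"
      by (simp only: power_mult_distrib mult.commute)
    then have "E powr (1 / real d) \<le> exp 1 * (real d / L)"
      using 2 E d by (subst powr_inverse_le_iff) auto
    also have "\<dots> \<le> exp 2 * (real d / L)" using 2 by (intro mult_right_mono) auto
    also have "moment_rate n s2 d = real d / L" using 2 by (auto simp: defs)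
    ultimately show ?thesis by simp
  next
    case 3
    \<comment> \<open>Since d < L, y is at most d. The estimate e^y - 1 \<le> y e^y then preserves
      the factor W, whose d-th root is the rate here.\<close>
    define y where "y = W * exp (real d)"
    have y0: "0 \<le> y" using W by (simp add: y_def)
    have "y \<le> W * exp L" using 3 W by (simp add: y_def)
    then have y: "y \<le> real d" unfolding eL using W by simp
    have "W * (exp (real d) - 1 - real d) \<le> y"
      unfolding y_def using W by (intro mult_left_mono) auto
    then have "exp (W * (exp (real d) - 1 - real d)) - 1 \<le> exp y - 1" by simp
    also have "\<dots> \<le> y * exp y"
    proof -
      have "1 - y \<le> exp (- y)" using exp_ge_add_one_self[of "- y"] by simp
      then have "(1 - y) * exp y \<le> exp (- y) * exp y" by (rule mult_right_mono) simp
      then show ?thesis by (simp add: algebra_simps flip: exp_add)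
    qed
    also have "\<dots> \<le> y * exp (real d)" using y y0 by (intro mult_left_mono) auto
    finally have "E \<le> y * exp (real d)" using bd[of "real d"] d by simp
    also have "\<dots> = W * exp (real d * 2)" by (simp add: y_def flip: exp_add)
    also have "\<dots> = (exp 2 * W powr (1 / real d)) ^ d"
      unfolding exp_of_nat_mult power_mult_distrib
      using W d by (simp add: powr_realpow[symmetric] powr_powr)
    finally have "E powr (1 / real d) \<le> exp 2 * W powr (1 / real d)"
      using E W d by (subst powr_inverse_le_iff) auto
    moreover have "moment_rate n s2 d = W powr (1 / real d)"
      using 3 by (auto simp: defs)
    ultimately show ?thesis by simp
  qed
qed

text \<open>The event that all n summands are 1 has probability (q / 2)^n, which is at least e^(-d),
  and on it the d-th power of the sum is n^d.\<close>

lemma sym_norm_ge_linear: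
  fixes q :: real
  assumes d: "d > 0" and n: "n \<ge> 1" and q: "q / 2 \<ge> exp (- x)" and x: "real n * x \<le> real d" and e: "even d" "q \<le> 1"
  shows "real n * exp (- 1) \<le> sum_moment (\<lambda>_. sym_moment q) n d powr (1 / real d)"
proof -
  have q0: "0 \<le> q" using q exp_gt_zero[of "- x"] by linarith
  have "exp (- 1) ^ d = exp (real d * (- 1))" by (rule exp_of_nat_mult[symmetric])
  also have "\<dots> \<le> exp (real n * (- x))" using x by simp
  also have "\<dots> = exp (- x) ^ n" by (rule exp_of_nat_mult)
  also have "\<dots> \<le> (q / 2) ^ n" using q by (intro power_mono) auto
  finally have "(real n * exp (- 1)) ^ d \<le> real n ^ d * (q / 2) ^ n"
    unfolding power_mult_distrib by (rule mult_left_mono) simp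
  also have "\<dots> \<le> sum_moment (\<lambda>_. sym_moment q) n d"
    using sum_moment_sym_ge_binomial[of q d n n] q0 e by (simp add: mult_ac)
  finally show ?thesis
    using d sum_moment_nonneg[of n "\<lambda>_. sym_moment q"] sym_moment_nonneg[OF q0 e(2)]
    by (subst powr_inverse_le_iff) auto
qed

text \<open>The first regime is split because pairing d / 2 distinct indices needs d \<le> 2n. For
  larger d the bound L < 2 forces q \<ge> 2 e^(-2), and the event that all summands are 1 suffices
  since the rate is then at most e n.\<close>

lemma rate_lower_bound:
  fixes n d :: nat and q :: real
  assumes n: "n \<ge> 1" and d: "d > 0" "even d" and q: "0 < q" "q \<le> 1"
    and regime: "\<not> (2 \<le> ln (real d / (real n * q)) \<and> ln (real d / (real n * q)) < real d / real n)"
  shows "exp (- 2) / 2 * moment_rate n q d \<le> sum_moment (\<lambda>_. sym_moment q) n d powr (1 / real d)"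
proof -
  define W where "W = real n * q"
  define L where "L = ln (real d / W)"
  define E where "E = sum_moment (\<lambda>_. sym_moment q) n d"
  have W: "W > 0" using n q by (simp add: W_def)
  have eL: "exp L = real d / W" using W d by (simp add: L_def)
  then have eL': "W = real d * exp (- L)" using W by (simp add: exp_minus field_simps)
  have E0: "E \<ge> 0"
    unfolding E_def by (rule sum_moment_nonneg) (use sym_moment_nonneg q in auto)
  note defs = moment_rate_def Let_def W_def[symmetric] mult.assoc L_def[symmetric]
  have e2: "exp (- 2) / 2 \<le> exp (- 1 :: real)"
    using exp_le_cancel_iff[of "-2::real" "-1"] exp_gt_zero[of "-2::real"] by linarith
  consider "L < 2" "d \<le> 2 * n" | "L < 2" "d > 2 * n"
    | "2 \<le> L" "real d / real n \<le> L" "L \<le> real d" | "2 \<le> L" "real d / real n \<le> L" "real d < L"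
    using regime unfolding W_def[symmetric] L_def[symmetric] by linarith
  then show ?thesis
  proof cases
    case 1
    obtain h where h: "d = 2 * h" using d by auto
    have hn: "h \<le> n" "h > 0" using 1 h d by auto
    \<comment> \<open>A single term of the series for e^d bounds the factorial from below.\<close>
    have f: "(real d * exp (- 1)) ^ d \<le> fact d"
    proof -
      have "(\<Sum>j\<in>{d}. real d ^ j / fact j) \<le> (\<Sum>j. real d ^ j / fact j)"
        using summable_exp[of "real d"] by (intro sum_le_suminf) (auto simp: divide_inverse mult.commute)
      then have "real d ^ d / fact d \<le> exp (real d)"
        by (simp add: exp_def divide_inverse mult.commute)
      then show ?thesis
        by (simp add: power_mult_distrib exp_minus field_simps flip: exp_of_nat_mult)
    qed
    have "(exp (- 1) * sqrt (real d * W)) ^ d = (real d * exp (- 1)) ^ d * (W / real d) ^ h"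
    proof -
      have "sqrt (real d * W) ^ d = (real d * W) ^ h"
        unfolding h power_mult using W by simp
      also have "\<dots> = real d ^ d * (W / real d) ^ h"
        unfolding h power_mult power_mult_distrib[symmetric] using d h
        by (simp add: power2_eq_square field_simps)
      finally show ?thesis by (simp add: power_mult_distrib mult_ac)
    qed
    also have "\<dots> \<le> fact d * (W / real d) ^ h"
      using f W by (intro mult_right_mono) auto
    also have "(W / real d) ^ h = (real n / real h) ^ h * (q ^ h / 2 ^ h)"
      unfolding power_divide[symmetric] power_mult_distrib[symmetric] by (simp add: W_def h mult.commute)
    also have "\<dots> \<le> real (n choose h) * (q ^ h / 2 ^ h)"
      using binomial_ge_n_over_k_pow_k[OF hn(1), where 'a = real] q by (intro mult_right_mono) auto
    also have "fact d * \<dots> \<le> E"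
      using sum_moment_sym_ge_factorial[of q h n] q unfolding E_def h by (simp add: mult_ac)
    finally have "(exp (- 1) * sqrt (real d * W)) ^ d \<le> E" by simp
    then have "exp (- 1) * sqrt (real d * W) \<le> E powr (1 / real d)"
      using d E0 W by (subst powr_inverse_le_iff) auto
    moreover have "moment_rate n q d = sqrt (real d * W)"
      using 1 by (auto simp: defs)
    moreover have "exp (- 2) / 2 * sqrt (real d * W) \<le> exp (- 1) * sqrt (real d * W)"
      using e2 W by (intro mult_right_mono) auto
    ultimately show ?thesis by (simp add: E_def)
  next
    case 2
    have Wn: "W \<le> real n" using q by (simp add: W_def mult_left_le)
    have dW: "real d \<le> exp 2 * W"
    proof -
      have "real d = exp L * W" unfolding eL using W by simp
      also have "\<dots> \<le> exp 2 * W" using 2 W by (intro mult_right_mono) auto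
      finally show ?thesis .
    qed
    have "2 * real n \<le> exp 2 * (real n * q)" using dW 2 by (simp add: W_def)
    then have "exp (- 2) * (2 * real n) \<le> exp (- 2) * (exp 2 * (real n * q))"
      by (rule mult_left_mono) simp
    also have "\<dots> = real n * q" by (simp flip: mult.assoc exp_add)
    finally have q2: "q / 2 \<ge> exp (- 2)" using n by (simp add: mult.left_commute)
    have *: "real n * exp (- 1) \<le> E powr (1 / real d)"
      unfolding E_def by (rule sym_norm_ge_linear[OF d(1) n q2 _ d(2) q(2)]) (use 2 in simp)
    have "sqrt (real d * W) \<le> sqrt ((exp 1 * real n)\<^sup>2)"
    proof (rule real_sqrt_le_mono)
      have "real d * W \<le> exp 2 * W * W" using dW W by (intro mult_right_mono) auto
      also have "\<dots> \<le> exp 2 * real n * real n" using Wn W by (intro mult_mono) auto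
      also have "\<dots> = (exp 1 * real n)\<^sup>2"
        by (simp add: power2_eq_square mult_ac) (simp flip: mult.assoc exp_add)
      finally show "real d * W \<le> (exp 1 * real n)\<^sup>2" .
    qed
    also have "\<dots> = exp 1 * real n" by simp
    finally have "exp (- 2) / 2 * sqrt (real d * W) \<le> exp (- 2) / 2 * (exp 1 * real n)"
      by (intro mult_left_mono) auto
    also have "\<dots> = exp (- 1) * real n / 2" by (simp flip: mult.assoc exp_add)
    also have "\<dots> \<le> real n * exp (- 1)" by simp
    also have "moment_rate n q d = sqrt (real d * W)"
      using 2 by (auto simp: defs)
    ultimately show ?thesis using * by (simp add: E_def)
  next
    case 3
    \<comment> \<open>The largest l for which e^(-L l), a lower bound for the weight of choosing l
      ones, is still at least e^(-d).\<close>
    define l where "l = nat \<lfloor>real d / L\<rfloor>"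
    have dL1: "1 \<le> real d / L" using 3 by simp
    have ll: "real l \<le> real d / L" "real d / L < real l + 1"
      using dL1 unfolding l_def by linarith+
    have l1: "l \<ge> 1" using dL1 unfolding l_def by linarith
    \<comment> \<open>Rounding down costs at most a factor 2 because l \<ge> 1; this is the 1 / 2 in
      the constant.\<close>
    have l2: "real d / (2 * L) \<le> real l" using ll l1 by (simp add: field_simps)
    have "real d / L \<le> real n" using 3 n by (simp add: field_simps)
    then have ln: "l \<le> n" using ll by linarith
    have expL: "2 * L \<le> exp L"
      using exp_lower_Taylor_quadratic[of L] 3 zero_le_power2[of "L - 1"]
      by (simp add: power2_diff)
    \<comment> \<open>Smallness of q serves the estimate 1 - q \<ge> e^(-2q) below; it follows from
      d / n \<le> L.\<close>
    have q12: "q \<le> 1 / 2"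
    proof -
      have "q = (real d / real n) * exp (- L)" using eL' n unfolding W_def by (simp add: field_simps)
      also have "\<dots> \<le> L * exp (- L)" using 3 by (intro mult_right_mono) auto
      also have "\<dots> \<le> 1 / 2" using expL by (simp add: exp_minus field_simps)
      finally show ?thesis .
    qed
    have A: "exp (- 1) ^ d \<le> (real n / real l) ^ l * (q / 2) ^ l"
    proof -
      have "exp (- 1) ^ d = exp (real d * (- 1))" by (rule exp_of_nat_mult[symmetric])
      also have "\<dots> \<le> exp (real l * (- L))" using ll 3 by (simp add: field_simps)
      also have "\<dots> = exp (- L) ^ l" by (rule exp_of_nat_mult)
      also have "\<dots> \<le> (real n / real l * (q / 2)) ^ l"
      proof (rule power_mono)
        have "2 * real l \<le> 2 * (real d / L)" using ll by simp
        also have "\<dots> \<le> real d" using 3 d by (simp add: field_simps)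
        finally have "exp (- L) * (2 * real l) \<le> exp (- L) * real d" by (intro mult_left_mono) auto
        then show "exp (- L) \<le> real n / real l * (q / 2)"
          using eL' l1 unfolding W_def by (simp add: field_simps)
      qed simp
      finally show ?thesis by (simp only: power_mult_distrib)
    qed
    \<comment> \<open>Requiring the remaining summands to vanish costs a second factor e^(-d), since
      2 W \<le> d.\<close>
    have B: "exp (- 1) ^ d \<le> (1 - q) ^ (n - l)"
    proof -
      have "- q - 2 * q\<^sup>2 \<le> ln (1 - q)" using ln_one_minus_pos_lower_bound[of q] q q12 by simp
      moreover have "2 * q\<^sup>2 \<le> q" using q q12 by (simp add: power2_eq_square)
      ultimately have "- 2 * q \<le> ln (1 - q)" by linarith
      then have "exp (- 2 * q) \<le> exp (ln (1 - q))" by simp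
      then have e: "exp (- 2 * q) \<le> 1 - q" using q12 by simp
      have "2 \<le> exp L" using exp_ge_add_one_self[of L] 3 by linarith
      then have "2 * W \<le> exp L * W" using W by (intro mult_right_mono) auto
      then have "2 * W \<le> real d" unfolding eL using W by simp
      then have "exp (real d * (- 1)) \<le> exp (real n * (- 2 * q))" by (simp add: W_def)
      also have "\<dots> = exp (- 2 * q) ^ n" by (rule exp_of_nat_mult)
      also have "\<dots> \<le> (1 - q) ^ n" using e by (intro power_mono) auto
      also have "\<dots> \<le> (1 - q) ^ (n - l)" using q by (intro power_decreasing) auto
      finally show ?thesis by (simp only: exp_of_nat_mult)
    qed
    have "(exp (- 2) * real l) ^ d = exp (- 1) ^ d * exp (- 1) ^ d * real l ^ d"
      by (simp flip: power_mult_distrib exp_add)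
    also have "\<dots> \<le> (real n / real l) ^ l * (q / 2) ^ l * (1 - q) ^ (n - l) * real l ^ d"
      using A B q by (intro mult_right_mono mult_mono) auto
    also have "\<dots> \<le> real (n choose l) * (q / 2) ^ l * (1 - q) ^ (n - l) * real l ^ d"
      using binomial_ge_n_over_k_pow_k[OF ln, where 'a = real] q by (intro mult_right_mono) auto
    also have "\<dots> \<le> E"
      unfolding E_def by (rule sum_moment_sym_ge_binomial) (use q d in auto)
    finally have "exp (- 2) * real l \<le> E powr (1 / real d)"
      using d E0 by (subst powr_inverse_le_iff) auto
    moreover have "exp (- 2) / 2 * (real d / L) \<le> exp (- 2) * real l"
      using mult_left_mono[OF l2, of "exp (- 2)"] by simp
    moreover have "moment_rate n q d = real d / L" using 3 by (auto simp: defs)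
    ultimately show ?thesis by (simp add: E_def)
  next
    case 4
    have "W \<le> E"
      using sum_moment_sym_ge_linear[of q d n] q d by (simp add: E_def W_def)
    then have "W powr (1 / real d) \<le> E powr (1 / real d)" using W by (intro powr_mono2) auto
    moreover have "exp (- 2) / 2 * W powr (1 / real d) \<le> 1 * W powr (1 / real d)"
      using order.trans[OF e2, of 1] by (intro mult_right_mono) auto
    moreover have "moment_rate n q d = W powr (1 / real d)" using 4 by (auto simp: defs)
    ultimately show ?thesis by (simp add: E_def)
  qed
qed

section \<open>The extremal moment\<close>

definition centred_law :: "'a measure \<Rightarrow> ('a \<Rightarrow> real) \<Rightarrow> real measure" where
  "centred_law P Z = distr P borel (\<lambda>\<omega>. Z \<omega> - mean P Z)"

lemma law_moment_distr:
  "Z \<in> borel_measurable P \<Longrightarrow> law_moment (distr P borel Z) u = mean P (\<lambda>\<omega>. Z \<omega> ^ u)"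
  by (subst integral_distr) auto

lemma AE_abs_le_1:
  assumes "Z \<in> borel_measurable P" "unit_law (distr P borel Z)"
  shows "AE \<omega> in P. \<bar>Z \<omega>\<bar> \<le> 1"
proof -
  have "AE x in distr P borel Z. \<bar>x\<bar> \<le> 1" using assms(2) unfolding unit_law_def by blast
  then show ?thesis by (rule AE_distrD[OF assms(1)])
qed

lemma unit_law_centred_law:
  assumes P: "prob_space P" and Z [measurable]: "Z \<in> borel_measurable P"
    and bd: "AE \<omega> in P. \<bar>Z \<omega> - mean P Z\<bar> \<le> 1"
  shows "unit_law (centred_law P Z)" "integrable P Z"
proof -
  interpret prob_space P by fact
  have "integrable P (\<lambda>\<omega>. Z \<omega> - mean P Z)"
    by (rule integrable_const_bound[where B = 1]) (use bd in auto)
  then have "integrable P (\<lambda>\<omega>. (Z \<omega> - mean P Z) + mean P Z)" by (rule Bochner_Integration.integrable_add) simp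
  then show i: "integrable P Z" by simp
  have "integral\<^sup>L (centred_law P Z) (\<lambda>x. x) = 0"
    unfolding centred_law_def using i by (subst integral_distr) (auto simp: prob_space)
  moreover have "real_distribution (centred_law P Z)"
    unfolding centred_law_def by (rule real_distribution_distr) simp
  moreover have "AE x in centred_law P Z. \<bar>x\<bar> \<le> 1"
    unfolding centred_law_def using bd by (subst AE_distr_iff) auto
  ultimately show "unit_law (centred_law P Z)" by (simp add: unit_law_def)
qed

text \<open>Centring preserves k-wise independence, so the moment expansion applies to the centred
  variables; the absolute value in the norm disappears because d is even.\<close>

lemma centred_norm_eq:
  assumes P: "prob_space P" and adm: "admissible P n k s2 X" and k: "k \<ge> 1"
    and d: "even d" "d \<le> k"
  shows "\<And>i. i < n \<Longrightarrow> unit_law (centred_law P (X i))"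
    "(\<Sum>i<n. law_moment (centred_law P (X i)) 2) \<le> real n * s2"
    "centred_norm P n d X
      = sum_moment (\<lambda>i. law_moment (centred_law P (X i))) n d powr (1 / real d)"
proof -
  interpret prob_space P by fact
  have ind: "kwise_indep P n k X" and bd: "\<And>i. i < n \<Longrightarrow> AE \<omega> in P. \<bar>X i \<omega> - mean P (X i)\<bar> \<le> 1"
    and v: "(\<Sum>i<n. var P (X i)) \<le> real n * s2"
    using adm by (auto simp: admissible_def)
  have X: "X i \<in> borel_measurable P" if "i < n" for i
    using kwise_indep_measurable[OF P ind k that] .
  show u: "unit_law (centred_law P (X i))" if "i < n" for i
    by (rule unit_law_centred_law[OF P X[OF that] bd[OF that]])
  have mom: "law_moment (centred_law P (X i)) u = mean P (\<lambda>\<omega>. (X i \<omega> - mean P (X i)) ^ u)"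
    if "i < n" for i u
    unfolding centred_law_def using X[OF that] by (intro law_moment_distr) simp
  show "(\<Sum>i<n. law_moment (centred_law P (X i)) 2) \<le> real n * s2"
    using v by (simp add: mom var_def)
  define Y where "Y i \<omega> = X i \<omega> - mean P (X i)" for i \<omega>
  have "kwise_indep P n k Y"
    unfolding kwise_indep_def
  proof (intro allI impI)
    fix J assume "J \<subseteq> {..<n} \<and> card J \<le> k"
    then have "indep_vars (\<lambda>_. borel) X J" using ind by (auto simp: kwise_indep_def)
    then show "indep_vars (\<lambda>_. borel) Y J"
      unfolding Y_def[abs_def]
      by (rule indep_vars_compose2[of "\<lambda>_. borel" X J "\<lambda>i y. y - mean P (X i)" "\<lambda>_. borel"]) simp
  qed
  then have "mean P (\<lambda>\<omega>. (\<Sum>i<n. Y i \<omega>) ^ d) = sum_moment (\<lambda>i u. mean P (\<lambda>\<omega>. Y i \<omega> ^ u)) n d"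
    by (rule integral_sum_power[OF P _ k]) (use bd d in \<open>auto simp: Y_def\<close>)
  also have "\<dots> = sum_moment (\<lambda>i. law_moment (centred_law P (X i))) n d"
    by (rule sum_moment_cong) (simp add: mom Y_def)
  finally have "mean P (\<lambda>\<omega>. (\<Sum>i<n. Y i \<omega>) ^ d)
      = sum_moment (\<lambda>i. law_moment (centred_law P (X i))) n d" .
  moreover have "mean P (\<lambda>\<omega>. \<Sum>i<n. X i \<omega>) = (\<Sum>i<n. mean P (X i))"
    using unit_law_centred_law(2)[OF P X bd] by (intro Bochner_Integration.integral_sum) auto
  ultimately show "centred_norm P n d X
      = sum_moment (\<lambda>i. law_moment (centred_law P (X i))) n d powr (1 / real d)"
    using d by (simp add: centred_norm_def Lp_norm_def power_even_abs Y_def sum_subtractf)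
qed

lemma admissible_of_unit_laws:
  assumes P: "prob_space P" and ind: "kwise_indep P n k X" and k: "k \<ge> 1"
    and d: "even d" "d \<le> k"
    and \<mu>: "\<And>i. i < n \<Longrightarrow> distr P borel (X i) = \<mu> i" "\<And>i. i < n \<Longrightarrow> unit_law (\<mu> i)"
    and v: "(\<Sum>i<n. law_moment (\<mu> i) 2) \<le> real n * s2"
  shows "admissible P n k s2 X"
    "centred_norm P n d X = sum_moment (\<lambda>i. law_moment (\<mu> i)) n d powr (1 / real d)"
proof -
  interpret prob_space P by fact
  have X: "X i \<in> borel_measurable P" if "i < n" for i
    using kwise_indep_measurable[OF P ind k that] .
  have mean: "mean P (X i) = 0" if "i < n" for i
    using law_moment_distr[OF X[OF that], of 1] \<mu>(1)[OF that] unit_law_moments(2)[OF \<mu>(2)[OF that]]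
    by simp
  have "AE \<omega> in P. \<bar>X i \<omega>\<bar> \<le> 1" if "i < n" for i
    using AE_abs_le_1[OF X[OF that]] \<mu>(1)[OF that] \<mu>(2)[OF that] by simp
  moreover have "var P (X i) = law_moment (\<mu> i) 2" if "i < n" for i
    using law_moment_distr[OF X[OF that], of 2] \<mu>(1)[OF that] mean[OF that] by (simp add: var_def)
  ultimately show adm: "admissible P n k s2 X"
    using ind v by (simp add: admissible_def mean)
  have "centred_law P (X i) = \<mu> i" if "i < n" for i
    using \<mu>(1)[OF that] mean[OF that] by (simp add: centred_law_def)
  then show "centred_norm P n d X = sum_moment (\<lambda>i. law_moment (\<mu> i)) n d powr (1 / real d)"
    unfolding centred_norm_eq(3)[OF P adm k d]
    by (intro arg_cong[where f = "\<lambda>E. E powr (1 / real d)"] sum_moment_cong) simp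
qed

text \<open>The norm depends on the centred laws only, so k-wise independent variables may be
  replaced by fully independent ones with these laws. The maximum becomes an optimisation over
  n-tuples of measures.\<close>

lemma attainable_norms_eq:
  assumes k: "k \<ge> 1" and d: "even d" "d \<le> k"
  shows "attainable_norms n k s2 d =
    {sum_moment (\<lambda>i. law_moment (\<mu> i)) n d powr (1 / real d) | \<mu>.
      (\<forall>i<n. unit_law (\<mu> i)) \<and> (\<Sum>i<n. law_moment (\<mu> i) 2) \<le> real n * s2}" (is "_ = ?A")
proof
  show "attainable_norms n k s2 d \<subseteq> ?A"
  proof
    fix x assume "x \<in> attainable_norms n k s2 d"
    then obtain P :: "(nat \<Rightarrow> real) measure" and X
      where P: "prob_space P" and adm: "admissible P n k s2 X" and x: "x = centred_norm P n d X"
      by (auto simp: attainable_norms_def)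
    show "x \<in> ?A"
      using centred_norm_eq[OF P adm k d] x
      by (intro CollectI exI[of _ "\<lambda>i. centred_law P (X i)"]) auto
  qed
next
  show "?A \<subseteq> attainable_norms n k s2 d"
  proof
    fix x assume "x \<in> ?A"
    then obtain \<mu> where \<mu>: "\<And>i. i < n \<Longrightarrow> unit_law (\<mu> i)"
      and v: "(\<Sum>i<n. law_moment (\<mu> i) 2) \<le> real n * s2"
      and x: "x = sum_moment (\<lambda>i. law_moment (\<mu> i)) n d powr (1 / real d)"
      by auto
    obtain Q :: "(nat \<Rightarrow> real) measure" and X where Q: "prob_space Q" "\<And>k. kwise_indep Q n k X"
      "\<And>i. i < n \<Longrightarrow> distr Q borel (X i) = \<mu> i"
      using prob_space_with_laws[of n \<mu>] \<mu> by (auto simp: unit_law_def)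
    show "x \<in> attainable_norms n k s2 d"
      unfolding attainable_norms_def
      using admissible_of_unit_laws[OF Q(1,2) k d Q(3) \<mu> v] x Q(1)
      by (intro CollectI exI[of _ Q] exI[of _ X]) auto
  qed
qed

text \<open>Single odd moments may be negative, so the sign is not visible termwise. It comes from
  realising the laws by independent variables: an even power has nonnegative mean.\<close>

lemma sum_law_moment_nonneg:
  assumes \<mu>: "\<And>i. i < n \<Longrightarrow> unit_law (\<mu> i)" and d: "even d"
  shows "0 \<le> sum_moment (\<lambda>i. law_moment (\<mu> i)) n d"
proof -
  obtain Q :: "(nat \<Rightarrow> real) measure" and X where Q: "prob_space Q" "\<And>k. kwise_indep Q n k X"
    "\<And>i. i < n \<Longrightarrow> distr Q borel (X i) = \<mu> i"
    using prob_space_with_laws[of n \<mu>] \<mu> by (auto simp: unit_law_def)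
  have X: "X i \<in> borel_measurable Q" if "i < n" for i
    by (rule kwise_indep_measurable[OF Q(1) Q(2)[of 1] order.refl that])
  have "AE \<omega> in Q. \<bar>X i \<omega>\<bar> \<le> 1" if "i < n" for i
    using AE_abs_le_1[OF X[OF that]] Q(3)[OF that] \<mu>[OF that] by simp
  then have "mean Q (\<lambda>\<omega>. (\<Sum>i<n. X i \<omega>) ^ d) = sum_moment (\<lambda>i u. mean Q (\<lambda>\<omega>. X i \<omega> ^ u)) n d"
    \<comment> \<open>\<open>Suc d\<close> rather than d, because the expansion asks for an order of
      at least 1 and d may be 0.\<close>
    by (intro integral_sum_power[OF Q(1) Q(2)[of "Suc d"]]) auto
  also have "\<dots> = sum_moment (\<lambda>i. law_moment (\<mu> i)) n d"
    using law_moment_distr[OF X] Q(3) by (intro sum_moment_cong) metis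
  finally have "mean Q (\<lambda>\<omega>. (\<Sum>i<n. X i \<omega>) ^ d) = sum_moment (\<lambda>i. law_moment (\<mu> i)) n d" .
  moreover have "0 \<le> mean Q (\<lambda>\<omega>. (\<Sum>i<n. X i \<omega>) ^ d)"
    by (rule Bochner_Integration.integral_nonneg) (rule zero_le_even_power[OF d])
  ultimately show ?thesis by simp
qed

text \<open>Replacing all moments by 1 turns the convolution into n^d by the binomial theorem; this
  is the trivial bound n for the sum, at the level of moments.\<close>

lemma abs_sum_moment_le_power:
  assumes "\<And>i u. i < n \<Longrightarrow> \<bar>x i u\<bar> \<le> 1"
  shows "\<bar>sum_moment x n d\<bar> \<le> real n ^ d"
  using assms
proof (induction n arbitrary: d)
  case 0
  then show ?case by simp
next
  case (Suc n)
  have "\<bar>sum_moment x (Suc n) d\<bar>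
      \<le> (\<Sum>j\<le>d. real (d choose j) * \<bar>sum_moment x n j\<bar> * \<bar>x n (d - j)\<bar>)"
    unfolding sum_moment.simps by (rule order.trans[OF sum_abs]) (simp add: abs_mult)
  also have "\<dots> \<le> (\<Sum>j\<le>d. real (d choose j) * real n ^ j * 1 ^ (d - j))"
    using Suc by (intro sum_mono mult_mono) auto
  also have "\<dots> = real (Suc n) ^ d" using binomial_ring[of "real n" 1 d] by (simp add: add.commute)
  finally show ?case .
qed

section \<open>Explicit three-valued laws\<close>

lemma unit_law_finite_pmf:
  fixes p :: "'b :: finite pmf" and f :: "'b \<Rightarrow> real"
  assumes "\<And>x. \<bar>f x\<bar> \<le> 1" "(\<Sum>x\<in>UNIV. f x * pmf p x) = 0"
  shows "unit_law (distr (measure_pmf p) borel f)"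
    "law_moment (distr (measure_pmf p) borel f) u = (\<Sum>x\<in>UNIV. f x ^ u * pmf p x)"
proof -
  have m: "law_moment (distr (measure_pmf p) borel f) u = (\<Sum>x\<in>UNIV. f x ^ u * pmf p x)" for u
    by (subst law_moment_distr) (auto simp: integral_measure_pmf_real[of UNIV])
  then show "law_moment (distr (measure_pmf p) borel f) u = (\<Sum>x\<in>UNIV. f x ^ u * pmf p x)" .
  have "real_distribution (distr (measure_pmf p) borel f)"
    by (rule prob_space.real_distribution_distr[OF measure_pmf.prob_space_axioms]) simp
  moreover have "AE x in distr (measure_pmf p) borel f. \<bar>x\<bar> \<le> 1"
    using assms by (subst AE_distr_iff) auto
  ultimately show "unit_law (distr (measure_pmf p) borel f)"
    using m[of 1] assms by (simp add: unit_law_def)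
qed

lemma sum_UNIV_bool_pair:
  "(\<Sum>x\<in>UNIV. h x) = h (True, True) + h (True, False) + h (False, True) + (h (False, False) :: real)"
proof -
  have "(\<Sum>x\<in>UNIV. h x) = (\<Sum>(a, b)\<in>UNIV \<times> UNIV. h (a, b))" by simp
  also have "\<dots> = (\<Sum>a\<in>UNIV. \<Sum>b\<in>UNIV. h (a, b))" by (rule sum.cartesian_product[symmetric])
  finally show ?thesis by (simp add: UNIV_bool)
qed

text \<open>A Bern(q) variable times an independent fair sign. Unlike B - B', this reaches every
  variance up to 1.\<close>

lemma sym_law_exists:
  assumes q: "0 \<le> q" "q \<le> 1"
  obtains \<mu> where "unit_law \<mu>" "\<And>u. law_moment \<mu> u = sym_moment q u"
proof -
  define p where "p = pair_pmf (bernoulli_pmf q) (bernoulli_pmf (1 / 2))"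
  define f :: "bool \<times> bool \<Rightarrow> real" where "f = (\<lambda>(a, b). of_bool a * (if b then 1 else - 1))"
  have f1: "\<bar>f x\<bar> \<le> 1" for x by (auto simp: f_def split: prod.splits)
  have f2: "(\<Sum>x\<in>UNIV. f x * pmf p x) = 0"
    using q by (simp add: sum_UNIV_bool_pair f_def p_def pmf_pair)
  have "(\<Sum>x\<in>UNIV. f x ^ u * pmf p x) = sym_moment q u" for u
    using q by (simp add: sum_UNIV_bool_pair f_def p_def pmf_pair sym_moment_def field_simps)
  then show ?thesis using that unit_law_finite_pmf[OF f1 f2] by auto
qed

lemma bern_diff_law_moments:
  assumes s2: "0 < s2" "s2 \<le> 1 / 2"
  defines "b \<equiv> bern_diff_law ((1 - sqrt (1 - 2 * s2)) / 2)"
  shows "unit_law b" "law_moment b u = sym_moment s2 u"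
proof -
  define p where "p = (1 - sqrt (1 - 2 * s2)) / 2"
  define r where "r = sqrt (1 - 2 * s2)"
  have r: "0 \<le> r" "r \<le> 1" using s2 by (simp_all add: r_def)
  have "p = (1 - r) / 2" by (simp add: p_def r_def)
  then have p0: "0 \<le> p" and p1: "p \<le> 1" using r by simp_all
  \<comment> \<open>The given p is the smaller root of p (1 - p) = s2 / 2.\<close>
  have "p * (1 - p) = (1 - (sqrt (1 - 2 * s2))\<^sup>2) / 4"
    by (simp add: p_def field_simps power2_eq_square)
  then have pq: "p * (1 - p) = s2 / 2" using s2 by simp
  define P where "P = pair_pmf (bernoulli_pmf p) (bernoulli_pmf p)"
  define f :: "bool \<times> bool \<Rightarrow> real" where "f = (\<lambda>(a, b). of_bool a - of_bool b)"
  have f1: "\<bar>f x\<bar> \<le> 1" for x by (auto simp: f_def split: prod.splits)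
  have f2: "(\<Sum>x\<in>UNIV. f x * pmf P x) = 0"
    using p0 p1 by (simp add: sum_UNIV_bool_pair f_def P_def pmf_pair)
  have b: "b = distr (measure_pmf P) borel f"
    by (simp add: b_def bern_diff_law_def P_def f_def p_def)
  show "unit_law b" unfolding b by (rule unit_law_finite_pmf(1)[OF f1 f2])
  have "(\<Sum>x\<in>UNIV. f x ^ u * pmf P x)
      = p * (1 - p) * (1 + (- 1) ^ u) + (1 - 2 * (p * (1 - p))) * 0 ^ u"
    using p0 p1 by (simp add: sum_UNIV_bool_pair f_def P_def pmf_pair algebra_simps)
  then show "law_moment b u = sym_moment s2 u"
    unfolding b unit_law_finite_pmf(2)[OF f1 f2] pq by (simp add: sym_moment_def)
qed

text \<open>A maximising sequence of tuples of laws has a subsequence with convergent moments. The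
  variance constraint is closed and the norm is continuous in finitely many moments, so the limit
  tuple attains the supremum, which is finite by the trivial bound n.\<close>

lemma attainable_norms_has_max:
  assumes k: "k \<ge> 1" and s2: "s2 > 0" and d: "d > 0" "even d" "d \<le> k"
  shows "\<exists>m \<in> attainable_norms n k s2 d. \<forall>x \<in> attainable_norms n k s2 d. x \<le> m"
    and "\<And>x. x \<in> attainable_norms n k s2 d \<Longrightarrow> x \<le> real n"
proof -
  define A where "A = attainable_norms n k s2 d"
  define F where "F \<mu> = sum_moment (\<lambda>i. law_moment (\<mu> i)) n d powr (1 / real d)" for \<mu>
  have A: "A = {F \<mu> | \<mu>. (\<forall>i<n. unit_law (\<mu> i)) \<and> (\<Sum>i<n. law_moment (\<mu> i) 2) \<le> real n * s2}"
    unfolding A_def F_def by (rule attainable_norms_eq) (use k d in auto)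
  have le: "x \<le> real n" if x: "x \<in> A" for x
  proof -
    from x obtain \<mu> where x: "x = F \<mu>" and \<mu>: "\<And>i. i < n \<Longrightarrow> unit_law (\<mu> i)" unfolding A by auto
    have "\<bar>sum_moment (\<lambda>i. law_moment (\<mu> i)) n d\<bar> \<le> real n ^ d"
      by (rule abs_sum_moment_le_power) (use unit_law_moments(5)[OF \<mu>] in auto)
    then show ?thesis
      unfolding x F_def using d sum_law_moment_nonneg[of n \<mu> d] \<mu>
      by (subst powr_inverse_le_iff) auto
  qed
  then show "\<And>x. x \<in> attainable_norms n k s2 d \<Longrightarrow> x \<le> real n" by (simp add: A_def)
  have bdd: "bdd_above A" using le by (auto simp: bdd_above_def)
  \<comment> \<open>The point mass at 0, as the case q = 0, provides an attainable value.\<close>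
  obtain \<delta> where \<delta>: "unit_law \<delta>" "\<And>u. law_moment \<delta> u = sym_moment 0 u"
    using sym_law_exists[of 0] by auto
  have "F (\<lambda>_. \<delta>) \<in> A"
    unfolding A using \<delta> s2 by (intro CollectI exI[of _ "\<lambda>_. \<delta>"]) (auto simp: sym_moment_def)
  then have ne: "A \<noteq> {}" by auto
  obtain a where a: "\<And>j. a j \<in> A" "a \<longlonglongrightarrow> Sup A"
    using closure_contains_Sup[OF ne bdd] unfolding closure_sequential by auto
  then have "\<forall>j. \<exists>\<mu>. a j = F \<mu> \<and> (\<forall>i<n. unit_law (\<mu> i)) \<and> (\<Sum>i<n. law_moment (\<mu> i) 2) \<le> real n * s2"
    unfolding A by blast
  then obtain \<mu> where \<mu>: "\<And>j. a j = F (\<mu> j)" "\<And>i j. i < n \<Longrightarrow> unit_law (\<mu> j i)"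
      "\<And>j. (\<Sum>i<n. law_moment (\<mu> j i) 2) \<le> real n * s2"
    by metis
  obtain r :: "nat \<Rightarrow> nat" and \<nu> where r: "strict_mono r" and \<nu>: "\<And>i. i < n \<Longrightarrow> unit_law (\<nu> i)"
      "\<And>i u. i < n \<Longrightarrow> (\<lambda>j. law_moment (\<mu> (r j) i) u) \<longlonglongrightarrow> law_moment (\<nu> i) u"
    using unit_laws_subseq[of n \<mu>] \<mu>(2) by blast
  have "(\<lambda>j. \<Sum>i<n. law_moment (\<mu> (r j) i) 2) \<longlonglongrightarrow> (\<Sum>i<n. law_moment (\<nu> i) 2)"
    by (intro tendsto_sum \<nu>(2)) simp
  then have "(\<Sum>i<n. law_moment (\<nu> i) 2) \<le> real n * s2"
    by (rule LIMSEQ_le_const2) (use \<mu>(3) in auto)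
  then have "F \<nu> \<in> A" unfolding A using \<nu>(1) by blast
  moreover have "(\<lambda>j. F (\<mu> (r j))) \<longlonglongrightarrow> F \<nu>"
    unfolding F_def
  proof (rule tendsto_powr')
    show "(\<lambda>j. sum_moment (\<lambda>i. law_moment (\<mu> (r j) i)) n d)
        \<longlonglongrightarrow> sum_moment (\<lambda>i. law_moment (\<nu> i)) n d"
      by (rule tendsto_sum_moment) (rule \<nu>(2))
    \<comment> \<open>The limit may be 0, where continuity of the root relies on the approximating
      moments being nonnegative.\<close>
    show "sum_moment (\<lambda>i. law_moment (\<nu> i)) n d \<noteq> 0 \<or> 0 < 1 / real d \<and>
        (\<forall>\<^sub>F j in sequentially. 0 \<le> sum_moment (\<lambda>i. law_moment (\<mu> (r j) i)) n d)"
      using d by (auto intro!: always_eventually sum_law_moment_nonneg \<mu>(2))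
  qed simp
  moreover have "(\<lambda>j. F (\<mu> (r j))) \<longlonglongrightarrow> Sup A"
    using LIMSEQ_subseq_LIMSEQ[OF a(2) r] \<mu>(1) by (simp add: comp_def)
  ultimately have "Sup A \<in> A" using LIMSEQ_unique by metis
  then show "\<exists>m \<in> attainable_norms n k s2 d. \<forall>x \<in> attainable_norms n k s2 d. x \<le> m"
    using cSup_upper[OF _ bdd] unfolding A_def by blast
qed

lemma attainable_norms_le_rate:
  assumes n: "n \<ge> 1" and k: "k \<ge> 1" and s2: "s2 > 0" and d: "d > 0" "even d" "d \<le> k"
    and regime: "\<not> (2 \<le> ln (real d / (real n * s2)) \<and> ln (real d / (real n * s2)) < real d / real n)"
    and x: "x \<in> attainable_norms n k s2 d"
  shows "x \<le> exp 2 * moment_rate n s2 d"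
proof -
  obtain \<mu> where \<mu>: "\<And>i. i < n \<Longrightarrow> unit_law (\<mu> i)"
    and v: "(\<Sum>i<n. law_moment (\<mu> i) 2) \<le> real n * s2"
    and x: "x = sum_moment (\<lambda>i. law_moment (\<mu> i)) n d powr (1 / real d)"
    using x unfolding attainable_norms_eq[OF k d(2,3)] by auto
  show ?thesis
    unfolding x
  proof (rule rate_upper_bound[OF n d(1) s2 _ _ regime])
    show "0 \<le> sum_moment (\<lambda>i. law_moment (\<mu> i)) n d"
      by (rule sum_law_moment_nonneg) (use \<mu> d in auto)
    fix t :: real assume t: "t > 0"
    have "\<bar>sum_moment (\<lambda>i. law_moment (\<mu> i)) n d\<bar>
        \<le> (real d / t) ^ d * (exp (real n * s2 * (exp t - 1 - t)) - 1)"
      by (rule abs_sum_moment_le[OF t d(1) _ _ _ _ v]) (use unit_law_moments[OF \<mu>] in auto)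
    then show "sum_moment (\<lambda>i. law_moment (\<mu> i)) n d
        \<le> (real d / t) ^ d * (exp (real n * s2 * (exp t - 1 - t)) - 1)" by simp
  qed
qed

lemma bern_diff_tuple_norm:
  assumes P: "prob_space P" and X: "bern_diff_tuple P n k s2 X"
    and k: "k \<ge> 1" and s2: "0 < s2" "s2 \<le> 1 / 2" and d: "even d" "d \<le> k"
  shows "admissible P n k s2 X"
    "centred_norm P n d X = sum_moment (\<lambda>_. sym_moment s2) n d powr (1 / real d)"
proof -
  let ?b = "bern_diff_law ((1 - sqrt (1 - 2 * s2)) / 2)"
  have X: "kwise_indep P n k X" "\<And>i. i < n \<Longrightarrow> distr P borel (X i) = ?b"
    using X by (auto simp: bern_diff_tuple_def)
  have b: "unit_law ?b" "\<And>u. law_moment ?b u = sym_moment s2 u"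
    using bern_diff_law_moments[OF s2] by auto
  have "(\<Sum>i<n. law_moment ?b 2) \<le> real n * s2"
    by (simp add: b(2) sym_moment_simps)
  from admissible_of_unit_laws[OF P X(1) k d X(2) b(1) this]
  show "admissible P n k s2 X"
    "centred_norm P n d X = sum_moment (\<lambda>_. sym_moment s2) n d powr (1 / real d)"
    unfolding b(2) by auto
qed

text \<open>The conditions on the rate are genuine. If 2 \<le> L < d / n with L = ln (d / (n s2)),
  which forces k > n, the first case of the rate applies although the norms never exceed n: for n =
  1, s2 = 1 / 2 and d \<ge> 4 the rate is sqrt (d / 2). Likewise the rate is unbounded as s2 grows,
  hence \<open>s2 \<le> 1\<close> in the lower bound. The comparison of Bernoulli differences with
  the maximum itself covers that range too.\<close>

theorem theorem1:
  shows "\<exists>c C r :: real. 0 < c \<and> c \<le> C \<and> 0 < r \<and>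
    (\<forall>(n::nat) (k::nat) (d::nat) (s2::real).
      n \<ge> 1 \<longrightarrow> k \<ge> 2 \<longrightarrow> s2 > 0 \<longrightarrow> d > 0 \<longrightarrow> even d \<longrightarrow> d \<le> k \<longrightarrow>
      (\<exists>m. m \<in> attainable_norms n k s2 d \<and> (\<forall>x \<in> attainable_norms n k s2 d. x \<le> m) \<and>
        (k \<le> n \<or> \<not> (2 \<le> ln (d / (n * s2)) \<and> ln (d / (n * s2)) < d / n) \<longrightarrow>
           m \<le> C * moment_rate n s2 d \<and>
           (s2 \<le> 1 \<longrightarrow> c * moment_rate n s2 d \<le> m)) \<and>
        (s2 \<le> 1 / 2 \<longrightarrow>
          (\<exists>(P :: (nat \<Rightarrow> real) measure) X. prob_space P \<and> bern_diff_tuple P n k s2 X) \<and>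
          (\<forall>(P :: (nat \<Rightarrow> real) measure) X. prob_space P \<longrightarrow> bern_diff_tuple P n k s2 X \<longrightarrow>
             admissible P n k s2 X \<and> r * m \<le> centred_norm P n d X))))"
proof (rule exI[of _ "exp (- 2) / 2"], rule exI[of _ "exp 2"], rule exI[of _ "exp (- 4) / 2"],
    intro conjI allI impI)
  show "exp (- 2) / 2 \<le> exp (2 :: real)"
    using exp_le_cancel_iff[of "- 2" "2 :: real"] exp_gt_zero[of "- 2 :: real"] by linarith
next
  fix n k d :: nat and s2 :: real
  assume n: "n \<ge> 1" and k2: "k \<ge> 2" and s2: "s2 > 0" and d: "d > 0" "even d" "d \<le> k"
  have k: "k \<ge> 1" using k2 by simp
  define L where "L = ln (real d / (real n * s2))"
  define N where "N = sum_moment (\<lambda>_. sym_moment s2) n d powr (1 / real d)"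
  obtain m where m: "m \<in> attainable_norms n k s2 d" "\<forall>x \<in> attainable_norms n k s2 d. x \<le> m"
    using attainable_norms_has_max(1)[OF k s2 d] by auto
  have up: "m \<le> exp 2 * moment_rate n s2 d" if "\<not> (2 \<le> L \<and> L < real d / real n)"
    using attainable_norms_le_rate[OF n k s2 d _ m(1)] that by (simp add: L_def)
  have low: "exp (- 2) / 2 * moment_rate n s2 d \<le> N"
    if "\<not> (2 \<le> L \<and> L < real d / real n)" "s2 \<le> 1"
    using rate_lower_bound[OF n d(1,2) s2] that by (simp add: L_def N_def)
  have Nm: "N \<le> m" if s1: "s2 \<le> 1"
  proof -
    obtain \<mu> where \<mu>: "unit_law \<mu>" "\<And>u. law_moment \<mu> u = sym_moment s2 u"
      using sym_law_exists[of s2] s2 s1 by auto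
    have "N \<in> attainable_norms n k s2 d"
      unfolding attainable_norms_eq[OF k d(2,3)] N_def
      using \<mu> by (intro CollectI exI[of _ "\<lambda>_. \<mu>"])
        (auto simp: sym_moment_simps intro!: arg_cong[where f = "\<lambda>E. E powr (1 / real d)"] sum_moment_cong)
    then show ?thesis using m by blast
  qed
  \<comment> \<open>Outside the exceptional range the constant is the quotient of the lower and the
    upper one; inside it both sides are compared with n.\<close>
  have rm: "exp (- 4) / 2 * m \<le> N" if s12: "s2 \<le> 1 / 2"
  proof (cases "2 \<le> L \<and> L < real d / real n")
    case False
    have "exp (- 4) / 2 * m \<le> exp (- 4) / 2 * (exp 2 * moment_rate n s2 d)"
      using up[OF False] by (intro mult_left_mono) auto
    also have "\<dots> = exp (- 2) / 2 * moment_rate n s2 d" by (simp flip: mult.assoc exp_add)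
    also have "\<dots> \<le> N" using low[OF False] s12 by simp
    finally show ?thesis .
  next
    case True
    have "exp L = real d / (real n * s2)" using n s2 d by (simp add: L_def)
    then have "s2 = real d / real n * exp (- L)" using n s2 by (simp add: exp_minus field_simps)
    \<comment> \<open>Here d / n exceeds 2, which absorbs the halving of s2 in the probability of
      the value 1.\<close>
    moreover have "2 * exp (- L) \<le> real d / real n * exp (- L)"
      using True by (intro mult_right_mono) auto
    ultimately have "exp (- L) \<le> s2 / 2" by linarith
    then have "real n * exp (- 1) \<le> N"
      unfolding N_def
      by (rule sym_norm_ge_linear[OF d(1) n]) (use True n d s12 in \<open>auto simp: field_simps\<close>)
    moreover have "exp (- 4) / 2 * m \<le> exp (- 1) * real n"
    proof -
      have e: "exp (- 4) / 2 \<le> exp (- 1 :: real)"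
        using exp_le_cancel_iff[of "- 4" "- 1 :: real"] exp_gt_zero[of "- 4 :: real"] by linarith
      have "exp (- 4) / 2 * m \<le> exp (- 4) / 2 * real n"
        by (rule mult_left_mono[OF attainable_norms_has_max(2)[OF k s2 d m(1)]]) simp
      also have "\<dots> \<le> exp (- 1) * real n" by (rule mult_right_mono[OF e]) simp
      finally show ?thesis .
    qed
    ultimately show ?thesis by (simp add: mult.commute)
  qed
  have ex: "\<exists>(P :: (nat \<Rightarrow> real) measure) X. prob_space P \<and> bern_diff_tuple P n k s2 X"
    if s12: "s2 \<le> 1 / 2"
  proof -
    let ?b = "bern_diff_law ((1 - sqrt (1 - 2 * s2)) / 2)"
    have "real_distribution ?b" using bern_diff_law_moments(1)[OF s2 s12] by (simp add: unit_law_def)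
    then obtain P :: "(nat \<Rightarrow> real) measure" and X where "prob_space P" "\<And>k. kwise_indep P n k X"
      "\<And>i. i < n \<Longrightarrow> distr P borel (X i) = ?b"
      using prob_space_with_laws[of n "\<lambda>_. ?b"] by auto
    then show ?thesis unfolding bern_diff_tuple_def by blast
  qed
  \<comment> \<open>If k \<le> n then d / n \<le> 1, so the exceptional range is empty.\<close>
  have regime: "\<not> (2 \<le> L \<and> L < real d / real n)"
    if "k \<le> n \<or> \<not> (2 \<le> ln (real d / (real n * s2)) \<and> ln (real d / (real n * s2)) < real d / real n)"
  proof (cases "k \<le> n")
    case True
    then have "real d / real n \<le> 1" using d n by simp
    then show ?thesis by linarith
  qed (use that in \<open>auto simp: L_def\<close>)
  show "\<exists>m. m \<in> attainable_norms n k s2 d \<and> (\<forall>x \<in> attainable_norms n k s2 d. x \<le> m) \<and>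
        (k \<le> n \<or> \<not> (2 \<le> ln (d / (n * s2)) \<and> ln (d / (n * s2)) < d / n) \<longrightarrow>
           m \<le> exp 2 * moment_rate n s2 d \<and>
           (s2 \<le> 1 \<longrightarrow> exp (- 2) / 2 * moment_rate n s2 d \<le> m)) \<and>
        (s2 \<le> 1 / 2 \<longrightarrow>
          (\<exists>(P :: (nat \<Rightarrow> real) measure) X. prob_space P \<and> bern_diff_tuple P n k s2 X) \<and>
          (\<forall>(P :: (nat \<Rightarrow> real) measure) X. prob_space P \<longrightarrow> bern_diff_tuple P n k s2 X \<longrightarrow>
             admissible P n k s2 X \<and> exp (- 4) / 2 * m \<le> centred_norm P n d X))"
  proof (intro exI[of _ m] conjI impI allI)
    assume *: "k \<le> n \<or> \<not> (2 \<le> ln (d / (n * s2)) \<and> ln (d / (n * s2)) < d / n)"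
    show "m \<le> exp 2 * moment_rate n s2 d" by (rule up[OF regime[OF *]])
    assume "s2 \<le> 1"
    then show "exp (- 2) / 2 * moment_rate n s2 d \<le> m"
      using low[OF regime[OF *]] Nm by linarith
  next
    fix P :: "(nat \<Rightarrow> real) measure" and X
    assume s12: "s2 \<le> 1 / 2" and P: "prob_space P" "bern_diff_tuple P n k s2 X"
    note t = bern_diff_tuple_norm[OF P k s2 s12 d(2,3)]
    show "admissible P n k s2 X" by (rule t(1))
    show "exp (- 4) / 2 * m \<le> centred_norm P n d X" using rm[OF s12] by (simp add: t(2) N_def)
  qed (use m ex in auto)
qed simp_all

end
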